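(* For every semipattern group $\mathbf{G}$, the equation solvability problem over $\mathbf{G}$ is solvable in polynomial time, i.e. there is an algorithm (depending on the fixed group $\mathbf{G}$) that decides, for any two group expressions $f,g$ over $\mathbf{G}$, whether the equation $f=g$ has a solution in $\mathbf{G}$, in time bounded by a polynomial in the total length of $f$ and $g$.
   Context: Equation solvability problem: let $\mathbf{G}$ be a fixed finite group. A group expression over $\mathbf{G}$ is a product of variables and elements of $\mathbf{G}$; its length is the number of factors. The equation solvability problem over $\mathbf{G}$ asks, given as input two group expressions over $\mathbf{G}$, whether they attain the same value for at least one substitution of elements of $\mathbf{G}$ for the variables (all occurrences of the same variable receiving the same value). The group $\mathbf{G}$ is fixed and not part of the input. Semipattern groups: let $\mathbb{F}_q$ be the finite field with $q$ elements, $\mathbb{F}_q^\times$ its multiplicative group, and $m\ge 1$ an integer. Let $\mathbf{T}(m,\mathbb{F}_q)$ be the group, under matrix multiplication, of $m\times m$ upper triangular matrices over $\mathbb{F}_q$ with nonzero diagonal entries. Let $I$ be the $m\times m$ identity matrix and let $I_{i,j}$ be the $m\times m$ matrix whose only nonzero entry is a $1$ in row $i$, column $j$. For $P\subseteq\{(i,j): 1\le i<j\le m\}$ put $$\mathbf{N}_P=\Big\{\, I+\sum_{(i,j)\in P} a_{i,j}I_{i,j} : a_{i,j}\in\mathbb{F}_q \,\Big\}.$$ If $\mathbf{N}_P$ is a subgroup of $\mathbf{T}(m,\mathbb{F}_q)$, it is called a pattern group. Let $\mathbf{S}_1,\dots,\mathbf{S}_m$ be subgroups of $\mathbb{F}_q^\times$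 and let $\mathbf{D}$ be the group of all diagonal $m\times m$ matrices whose $i$-th diagonal entry lies in $\mathbf{S}_i$ for every $1\le i\le m$. If $\mathbf{N}_P$ is a pattern group, then $\mathbf{N}_P\mathbf{D}$ is a subgroup of $\mathbf{T}(m,\mathbb{F}_q)$ (isomorphic to $\mathbf{N}_P\rtimes\mathbf{D}$), and any group of the form $\mathbf{N}_P\mathbf{D}$ is called a semipattern group. *)

theory Defs
  imports
    "HOL-Algebra.Coset"
    "HOL-Computational_Algebra.Polynomial"
    "Jordan_Normal_Form.Matrix"
begin

section \<open>Semipattern groups\<close>

text \<open>
  The field with q elements is a type of sort \<open>{field, finite}\<close>. Matrices are those of
  \<open>Jordan_Normal_Form\<close>, so rows and columns are numbered from 0 to m - 1.
\<close>

definition field_units :: "'a::field monoid" where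
  "field_units = \<lparr>carrier = UNIV - {0}, monoid.mult = (*), one = 1\<rparr>"

definition triangular_group :: "nat \<Rightarrow> 'a::field mat monoid" where
  "triangular_group m =
     \<lparr>carrier = {A \<in> carrier_mat m m. upper_triangular A \<and> (\<forall>i<m. A $$ (i, i) \<noteq> 0)},
      monoid.mult = (*), one = 1\<^sub>m m\<rparr>"

text \<open>
  \<open>P\<close> consists of positions strictly above the diagonal; the matrix below is
  I + (sum over (i, j) in P of a(i, j) I(i, j)), written out entrywise.
\<close>

definition pattern_set :: "nat \<Rightarrow> (nat \<times> nat) set \<Rightarrow> 'a::field mat set" where
  "pattern_set m P =
     {mat m m (\<lambda>(i, j). (if i = j then 1 else 0) + (if (i, j) \<in> P then a i j else 0)) |a. True}"

definition diagonal_set :: "nat \<Rightarrow> (nat \<Rightarrow> 'a::field set) \<Rightarrow> 'a mat set" where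
  "diagonal_set m S = {mat_diag m s |s. \<forall>i<m. s i \<in> S i}"

definition semipattern_group :: "'a::{field,finite} mat monoid \<Rightarrow> bool" where
  "semipattern_group G \<longleftrightarrow>
     (\<exists>m P S. 1 \<le> m \<and> P \<subseteq> {(i, j). i < j \<and> j < m} \<and>
        subgroup (pattern_set m P) (triangular_group m :: 'a mat monoid) \<and>
        (\<forall>i<m. subgroup (S i) field_units) \<and>
        G = (triangular_group m)
              \<lparr>carrier := pattern_set m P <#>\<^bsub>triangular_group m\<^esub> diagonal_set m S\<rparr>)"

section \<open>Group expressions and equations\<close>

datatype 'g factor = Var nat | Const 'g

text \<open>The length of an expression, as a list, is its number of factors.\<close>

type_synonym 'g group_expr = "'g factor list"

definition group_exprs :: "('g, 'b) monoid_scheme \<Rightarrow> 'g group_expr set" where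
  "group_exprs G = {f. \<forall>c. Const c \<in> set f \<longrightarrow> c \<in> carrier G}"

definition vars :: "'g group_expr \<Rightarrow> nat set" where
  "vars f = {v. Var v \<in> set f}"

fun factor_value :: "(nat \<Rightarrow> 'g) \<Rightarrow> 'g factor \<Rightarrow> 'g" where
  "factor_value \<sigma> (Var v) = \<sigma> v"
| "factor_value \<sigma> (Const c) = c"

definition expr_value :: "('g, 'b) monoid_scheme \<Rightarrow> (nat \<Rightarrow> 'g) \<Rightarrow> 'g group_expr \<Rightarrow> 'g" where
  "expr_value G \<sigma> f = foldr (\<lambda>t x. factor_value \<sigma> t \<otimes>\<^bsub>G\<^esub> x) f \<one>\<^bsub>G\<^esub>"

definition eq_solvable :: "('g, 'b) monoid_scheme \<Rightarrow> 'g group_expr \<Rightarrow> 'g group_expr \<Rightarrow> bool" where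
  "eq_solvable G f g \<longleftrightarrow>
     (\<exists>\<sigma>. (\<forall>v. \<sigma> v \<in> carrier G) \<and> expr_value G \<sigma> f = expr_value G \<sigma> g)"

section \<open>Deterministic multitape Turing machines\<close>

text \<open>
  States and tape symbols are initial segments of the natural numbers; symbol 0 is the blank.
  Tapes are infinite in both directions. In one step a machine reads the symbols under all its
  heads, then writes on every tape and moves every head by at most one cell.
\<close>

datatype head_move = Go_Left | Stay | Go_Right

record turing_machine =
  num_tapes :: nat
  num_states :: nat
  num_symbols :: nat
  start_state :: nat
  accept_state :: nat
  reject_state :: nat
  delta :: "nat \<Rightarrow> nat list \<Rightarrow> nat \<times> (nat \<times> head_move) list"

text \<open>
  Only the restriction of \<open>delta\<close> to the finite set of states and symbols matters; the last
  condition says that this restriction stays within the finitely many states and symbols.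
\<close>

definition wf_tm :: "turing_machine \<Rightarrow> bool" where
  "wf_tm M \<longleftrightarrow>
     1 \<le> num_tapes M \<and> 1 \<le> num_symbols M \<and>
     start_state M < num_states M \<and> accept_state M < num_states M \<and>
     reject_state M < num_states M \<and> accept_state M \<noteq> reject_state M \<and>
     (\<forall>q < num_states M. \<forall>xs. length xs = num_tapes M \<and> set xs \<subseteq> {..<num_symbols M} \<longrightarrow>
        fst (delta M q xs) < num_states M \<and>
        length (snd (delta M q xs)) = num_tapes M \<and>
        fst ` set (snd (delta M q xs)) \<subseteq> {..<num_symbols M})"

text \<open>A tape is a head position together with the contents of the cells.\<close>

type_synonym tape = "int \<times> (int \<Rightarrow> nat)"
type_synonym config = "nat \<times> tape list"

fun read_tape :: "tape \<Rightarrow> nat" where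
  "read_tape (h, c) = c h"

fun offset :: "head_move \<Rightarrow> int" where
  "offset Go_Left = -1"
| "offset Stay = 0"
| "offset Go_Right = 1"

fun act_tape :: "nat \<times> head_move \<Rightarrow> tape \<Rightarrow> tape" where
  "act_tape (s, d) (h, c) = (h + offset d, c(h := s))"

text \<open>The accepting and the rejecting state are halting: no step leaves them.\<close>

fun tm_step :: "turing_machine \<Rightarrow> config \<Rightarrow> config" where
  "tm_step M (q, ts) =
     (if q = accept_state M \<or> q = reject_state M then (q, ts)
      else (let (q', acts) = delta M q (map read_tape ts) in (q', map2 act_tape acts ts)))"

text \<open>The input stands in cells 0, 1, ... of the first tape; all other cells are blank.\<close>

definition initial_config :: "turing_machine \<Rightarrow> nat list \<Rightarrow> config" where
  "initial_config M w =
     (start_state M,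
      (0, \<lambda>z. if 0 \<le> z \<and> z < int (length w) then w ! nat z else 0)
        # replicate (num_tapes M - 1) (0, \<lambda>z. 0))"

text \<open>On input \<open>w\<close>, \<open>M\<close> halts after at most \<open>t\<close> steps with the answer \<open>b\<close>.\<close>

definition answers_within :: "turing_machine \<Rightarrow> nat list \<Rightarrow> bool \<Rightarrow> nat \<Rightarrow> bool" where
  "answers_within M w b t \<longleftrightarrow>
     set w \<subseteq> {..<num_symbols M} \<and>
     (\<exists>t'\<le>t. fst ((tm_step M ^^ t') (initial_config M w)) =
              (if b then accept_state M else reject_state M))"

section \<open>The equation solvability problem\<close>

text \<open>
  Input symbols: 1 and 2 are the binary digits 0 and 1, 3 announces a variable and is followed
  by the binary index of that variable (least significant digit first), 4 separates the two
  sides of the equation, and 5 + k is the group element with number k.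
\<close>

fun binary :: "nat \<Rightarrow> nat list" where
  "binary n = (if n = 0 then [] else (if even n then 1 else 2) # binary (n div 2))"

declare binary.simps [simp del]

fun encode_factor :: "('g \<Rightarrow> nat) \<Rightarrow> 'g factor \<Rightarrow> nat list" where
  "encode_factor code (Var v) = 3 # binary v"
| "encode_factor code (Const c) = [5 + code c]"

definition encode_equation :: "('g \<Rightarrow> nat) \<Rightarrow> 'g group_expr \<Rightarrow> 'g group_expr \<Rightarrow> nat list" where
  "encode_equation code f g =
     concat (map (encode_factor code) f) @ [4] @ concat (map (encode_factor code) g)"

text \<open>
  The group is fixed: machine and polynomial may depend on it, and on the way its elements are
  numbered, which is arbitrary. The machine has to answer correctly on all inputs. Since variable
  names can be arbitrarily long words, its running time is bounded by a polynomial in the number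
  of input symbols; and by a polynomial in the total number of factors of the two expressions
  when the variables are named, as they always can be, by numbers less than this total.
\<close>

definition eq_solvability_in_P :: "('g, 'b) monoid_scheme \<Rightarrow> bool" where
  "eq_solvability_in_P G \<longleftrightarrow>
     (\<forall>code. bij_betw code (carrier G) {..<card (carrier G)} \<longrightarrow>
       (\<exists>M (p :: nat poly). wf_tm M \<and>
         (\<forall>f \<in> group_exprs G. \<forall>g \<in> group_exprs G.
            answers_within M (encode_equation code f g) (eq_solvable G f g)
              (poly p (length (encode_equation code f g))) \<and>
            (vars f \<union> vars g \<subseteq> {..<length f + length g} \<longrightarrow>
              answers_within M (encode_equation code f g) (eq_solvable G f g)
                (poly p (length f + length g))))))"

end

theory Submission
  imports Defs
begin

text \<open>
  The carrier of a semipattern group is closed under entrywise multiplication, and its entries on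
  the diagonal and at the positions in \<open>P\<close> are multiplicative functions for this operation. Under an
  assignment, an equation \<open>f = g\<close> holds iff the product of \<open>f\<^sub>i\<^sub>j - g\<^sub>i\<^sub>j + a\<close> over all \<open>i\<close>, \<open>j\<close> and all
  field elements \<open>a \<noteq> 0\<close> is nonzero. As the matrices are upper triangular, this product is a sum
  over paths that ascend in a fixed finite set of states, hence a sum of polynomially many terms,
  each a constant times a multiplicative function of the assignment. Distinct multiplicative
  functions are linearly independent, so the equation is solvable iff for some term the coefficients
  of all terms with the same multiplicative function have a nonzero sum. This is checked by a fixed
  number of nested loops over the positions of the input with finite memory, that is, by a Turing
  machine with one head for each loop.
\<close>

text \<open>Assignments are exponentially many, so nothing may be computed per assignment;
  independence replaces the search by a computation with coefficients. It decides, however, whether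
  one sum is nonzero, while an equation is a conjunction of vanishing entries. The product over all
  nonzero field elements turns this conjunction into a single nonvanishing condition and uses only
  sums and products, under which the automata are closed. Matrix multiplication would not make the
  entries multiplicative; the constraints that define the carrier (a group of units at each diagonal
  place, zeros at the places outside \<open>P\<close>) survive entrywise products. A second obstacle
  is the number of variables: the multiplicative function of a term depends on all variables at once
  and does not fit into finite memory. But it is a product of one function for each variable, and
  these come from a finite set because the carrier is finite, so two terms can be compared one
  variable at a time. Names of variables are unbounded words as well; a variable is represented by a
  position at which it occurs.\<close>

section \<open>Queries over a word with finitely many read-only pointers\<close>

text \<open>
  Positions are counted from the blank in front of the word: position \<open>p\<close> is cell \<open>p - 1\<close> of the
  tape.
\<close>

definition padded :: "nat \<Rightarrow> nat list \<Rightarrow> nat list" where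
  "padded Z w = 0 # w @ [Z]"

definition pad_sym :: "nat \<Rightarrow> nat list \<Rightarrow> nat \<Rightarrow> nat" where
  "pad_sym Z w p = (if p < length w + 2 then padded Z w ! p else 0)"

definition pad_tape :: "nat \<Rightarrow> nat list \<Rightarrow> int \<Rightarrow> nat" where
  "pad_tape Z w z = (if 0 \<le> z then pad_sym Z w (nat z + 1) else 0)"

text \<open>The truncated subtraction is harmless: position 0 carries the blank, and the condition
  of a well-formed scan fails there.\<close>

fun shift :: "head_move \<Rightarrow> nat \<Rightarrow> nat \<Rightarrow> nat" where
  "shift Go_Left n p = p - n"
| "shift Stay n p = p"
| "shift Go_Right n p = p + n"

text \<open>
  \<open>Scan d C r i j\<close> moves the pointers \<open>i\<close> and \<open>j\<close> in lockstep in direction \<open>d\<close> while \<open>C\<close> holds of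
  the symbols under them (its first argument tells whether they still are where they started) and
  returns \<open>r\<close> of the symbols where they stop.
\<close>

datatype query =
    Scan head_move "bool \<Rightarrow> nat \<Rightarrow> nat \<Rightarrow> bool" "nat \<Rightarrow> nat \<Rightarrow> nat" nat nat
  | App "nat \<Rightarrow> nat \<Rightarrow> nat" query query
  | Fold nat "nat \<Rightarrow> nat \<Rightarrow> nat" nat query

definition scan_len ::
  "nat \<Rightarrow> nat list \<Rightarrow> head_move \<Rightarrow> (bool \<Rightarrow> nat \<Rightarrow> nat \<Rightarrow> bool) \<Rightarrow> nat \<Rightarrow> nat \<Rightarrow> nat" where
  "scan_len Z w d C p p' =
     (LEAST n. \<not> C (n = 0) (pad_sym Z w (shift d n p)) (pad_sym Z w (shift d n p')))"

fun query_value :: "nat \<Rightarrow> nat list \<Rightarrow> (nat \<Rightarrow> nat) \<Rightarrow> query \<Rightarrow> nat" where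
  "query_value Z w e (Scan d C r i j) =
     (let n = scan_len Z w d C (e i) (e j)
      in r (pad_sym Z w (shift d n (e i))) (pad_sym Z w (shift d n (e j))))"
| "query_value Z w e (App F q q') = F (query_value Z w e q) (query_value Z w e q')"
| "query_value Z w e (Fold i F a q) =
     foldl (\<lambda>x p. F x (query_value Z w (e(i := p)) q)) a [0..<length w + 2]"

text \<open>Bound pointers increase inwards, so that no pointer is bound again within its scope.\<close>

fun wf_query :: "nat \<Rightarrow> nat \<Rightarrow> nat \<Rightarrow> query \<Rightarrow> bool" where
  "wf_query V H n (Scan d C r i j) \<longleftrightarrow>
     d \<noteq> Stay \<and> (\<forall>b x y. C b x y \<longrightarrow> x \<noteq> 0 \<and> y \<noteq> 0) \<and> (\<forall>x y. r x y < V) \<and> i < H \<and> j < H"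
| "wf_query V H n (App F q q') \<longleftrightarrow> (\<forall>x y. F x y < V) \<and> wf_query V H n q \<and> wf_query V H n q'"
| "wf_query V H n (Fold i F a q) \<longleftrightarrow>
     n \<le> i \<and> i < H \<and> a < V \<and> (\<forall>x y. F x y < V) \<and> wf_query V H (Suc i) q"

lemma wf_query_mono:
  "wf_query V H n q \<Longrightarrow> V \<le> V' \<Longrightarrow> H \<le> H' \<Longrightarrow> n' \<le> n \<Longrightarrow> wf_query V' H' n' q"
proof (induction q arbitrary: n n')
  case (Fold i F a q)
  then show ?case by (fastforce intro: less_le_trans)
qed (fastforce intro: less_le_trans)+

lemma foldl_closed: "x \<in> A \<Longrightarrow> (\<And>x p. x \<in> A \<Longrightarrow> p \<in> set ps \<Longrightarrow> f x p \<in> A) \<Longrightarrow> foldl f x ps \<in> A"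
  by (induction ps arbitrary: x) auto

lemma query_value_less: "wf_query V H n q \<Longrightarrow> query_value Z w e q < V"
proof (cases q)
  case (Fold i F a q')
  assume "wf_query V H n q"
  then show ?thesis using foldl_closed[of a "{..<V}"] Fold by auto
qed (auto simp: Let_def)

lemma pad_sym_0 [simp]: "pad_sym Z w 0 = 0"
  by (simp add: pad_sym_def padded_def)

lemma pad_sym_beyond: "length w + 2 \<le> p \<Longrightarrow> pad_sym Z w p = 0"
  by (simp add: pad_sym_def)

text \<open>The ends of the word are recognised by the blank alone: scans, loops and rewinding rely
  on its absence from the inside of the padded word.\<close>

lemma pad_sym_eq_0_iff:
  assumes "set w \<subseteq> {1..<Z}" and "0 < Z"
  shows "pad_sym Z w p = 0 \<longleftrightarrow> p = 0 \<or> length w + 2 \<le> p"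
proof (cases p)
  case (Suc p')
  have "w ! p' \<noteq> 0" if "p' < length w" using assms nth_mem[OF that] by auto
  then show ?thesis using Suc assms by (auto simp: pad_sym_def padded_def nth_append)
qed simp

lemma pad_tape_shift [simp]: "pad_tape Z w (int p - 1) = pad_sym Z w p"
  by (cases p) (auto simp: pad_tape_def)

lemma scan_stops:
  assumes C: "\<And>b x y. C b x y \<Longrightarrow> x \<noteq> 0" and d: "d \<noteq> Stay" and p: "p < length w + 2"
  shows "\<exists>n\<le>length w + 1. \<not> C (n = 0) (pad_sym Z w (shift d n p)) (y n)"
\<comment> \<open>Separated because \<open>length w + 1\<close> steps to the right from position 0
  end on the final \<open>Z\<close>; but from there the scan does not start at all, as it reads the
  blank.\<close>
proof (cases "d = Go_Right \<and> p = 0")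
  case True
  then show ?thesis using C[of True "pad_sym Z w 0"] by (intro exI[of _ 0]) auto
next
  case False
  then have "pad_sym Z w (shift d (length w + 1) p) = 0"
    using d p by (cases d) (auto simp: pad_sym_beyond)
  then show ?thesis using C[of False 0] by (intro exI[of _ "length w + 1"]) auto
qed

text \<open>The counter tape carries a copy of the padded word too. This bound keeps its head on
  nonblank cells while the count is positive, so that a blank means count 0.\<close>

lemma scan_len_le:
  assumes "\<And>b x y. C b x y \<Longrightarrow> x \<noteq> 0" and "d \<noteq> Stay" and "p < length w + 2"
  shows "scan_len Z w d C p p' \<le> length w + 1"
proof -
  have "\<exists>n\<le>length w + 1. \<not> C (n = 0) (pad_sym Z w (shift d n p)) (pad_sym Z w (shift d n p'))"
    by (rule scan_stops) (use assms in auto)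
  then obtain n where "n \<le> length w + 1"
    and "\<not> C (n = 0) (pad_sym Z w (shift d n p)) (pad_sym Z w (shift d n p'))" by blast
  then show ?thesis unfolding scan_len_def by (intro order_trans[OF Least_le])
qed

lemma scan_len_stop:
  assumes "\<And>b x y. C b x y \<Longrightarrow> x \<noteq> 0" and "d \<noteq> Stay" and "p < length w + 2"
    and n: "n = scan_len Z w d C p p'"
  shows "\<not> C (n = 0) (pad_sym Z w (shift d n p)) (pad_sym Z w (shift d n p'))"
proof -
  have "\<exists>n\<le>length w + 1. \<not> C (n = 0) (pad_sym Z w (shift d n p)) (pad_sym Z w (shift d n p'))"
    by (rule scan_stops) (use assms in auto)
  then have "\<exists>n. \<not> C (n = 0) (pad_sym Z w (shift d n p)) (pad_sym Z w (shift d n p'))" by blast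
  then show ?thesis unfolding n scan_len_def by (rule LeastI_ex)
qed

lemma scan_len_continue:
  "m < scan_len Z w d C p p' \<Longrightarrow>
     C (m = 0) (pad_sym Z w (shift d m p)) (pad_sym Z w (shift d m p'))"
  unfolding scan_len_def using not_less_Least by blast

section \<open>Turing machines answering queries\<close>

text \<open>\<open>Go\<close> and \<open>Return\<close> are the two phases of a scan; the flag of
  \<open>Go\<close> is the first argument of its condition. \<open>Next\<close>, \<open>Test\<close>
  and \<open>Rew\<close> control the loop of a fold; moving and testing are separate because a step
  reads before it moves.\<close>

datatype instr =
    Compute query
  | Comb "nat \<Rightarrow> nat \<Rightarrow> nat"
  | Go bool head_move "bool \<Rightarrow> nat \<Rightarrow> nat \<Rightarrow> bool" "nat \<Rightarrow> nat \<Rightarrow> nat" nat nat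
  | Return head_move nat nat
  | Next nat "nat \<Rightarrow> nat \<Rightarrow> nat" query
  | Test nat "nat \<Rightarrow> nat \<Rightarrow> nat" query
  | Rew nat

type_synonym control = "instr list \<times> nat list"

fun opposite :: "head_move \<Rightarrow> head_move" where
  "opposite Go_Left = Go_Right"
| "opposite Stay = Stay"
| "opposite Go_Right = Go_Left"

text \<open>
  The finite control consists of a list of instructions still to be executed and a stack of values.
  Tape \<open>H\<close> counts how far a scan has gone, so that the pointers can be brought back.
\<close>

fun control_step :: "nat \<Rightarrow> (nat \<Rightarrow> nat) \<Rightarrow> control \<Rightarrow> control \<times> (nat \<Rightarrow> head_move)" where
  "control_step H s (Compute (Scan d C r i j) # k, vs) = ((Go True d C r i j # k, vs), \<lambda>_. Stay)"
| "control_step H s (Compute (App F q q') # k, vs) =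
     ((Compute q # Compute q' # Comb F # k, vs), \<lambda>_. Stay)"
| "control_step H s (Compute (Fold i F a q) # k, vs) =
     ((Compute q # Comb F # Next i F q # k, a # vs), \<lambda>_. Stay)"
| "control_step H s (Comb F # k, vs) = ((k, F (hd (tl vs)) (hd vs) # tl (tl vs)), \<lambda>_. Stay)"
| "control_step H s (Go b d C r i j # k, vs) =
     (if C b (s i) (s j)
      then ((Go False d C r i j # k, vs),
        \<lambda>x. if x = H then Go_Right else if x = i \<or> x = j then d else Stay)
      else ((Return d i j # k, r (s i) (s j) # vs), \<lambda>_. Stay))"
| "control_step H s (Return d i j # k, vs) =
     (if s H = 0 then ((k, vs), \<lambda>_. Stay)
      else ((Return d i j # k, vs),
        \<lambda>x. if x = H then Go_Left else if x = i \<or> x = j then opposite d else Stay))"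
| "control_step H s (Next i F q # k, vs) =
     ((Test i F q # k, vs), \<lambda>x. if x = i then Go_Right else Stay)"
| "control_step H s (Test i F q # k, vs) =
     (if s i = 0 then ((Rew i # k, vs), \<lambda>x. if x = i then Go_Left else Stay)
      else ((Compute q # Comb F # Next i F q # k, vs), \<lambda>_. Stay))"
| "control_step H s (Rew i # k, vs) =
     (if s i = 0 then ((k, vs), \<lambda>_. Stay)
      else ((Rew i # k, vs), \<lambda>x. if x = i then Go_Left else Stay))"
| "control_step H s ([], vs) = (([], vs), \<lambda>_. Stay)"

fun instrs :: "query \<Rightarrow> instr set" where
  "instrs (Scan d C r i j) =
     {Compute (Scan d C r i j), Go True d C r i j, Go False d C r i j, Return d i j}"
| "instrs (App F q q') = {Compute (App F q q'), Comb F} \<union> instrs q \<union> instrs q'"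
| "instrs (Fold i F a q) =
     {Compute (Fold i F a q), Comb F, Next i F q, Test i F q, Rew i} \<union> instrs q"

lemma finite_instrs [simp]: "finite (instrs q)"
  by (induction q) auto

lemma Compute_in_instrs [simp]: "Compute q \<in> instrs q"
  by (cases q) auto

text \<open>One bound for two quantities: the instructions and the stack values that the computation
  of the query may add to those already present.\<close>

fun depth :: "query \<Rightarrow> nat" where
  "depth (Scan d C r i j) = 2"
| "depth (App F q q') = depth q + depth q' + 3"
| "depth (Fold i F a q) = depth q + 3"

lemma depth_pos: "1 \<le> depth q"
  by (cases q) auto

text \<open>A fold makes \<open>length w + 2\<close> rounds; the 3 in each stands for
  \<open>Comb\<close>, \<open>Next\<close> and \<open>Test\<close>, the summand in front for
  starting and rewinding.\<close>

fun time_poly :: "query \<Rightarrow> nat poly" where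
  "time_poly (Scan d C r i j) = [:6, 2:]"
| "time_poly (App F q q') = time_poly q + time_poly q' + [:2:]"
| "time_poly (Fold i F a q) = [:3, 1:] + [:2, 1:] * (time_poly q + [:3:])"

section \<open>The Turing machine of a query\<close>

datatype mstate = Load | Rewind | Run control | Yes | No

locale query_machine =
  fixes Z V H :: nat and q :: query
  assumes wf: "wf_query V H 0 q" and Z_pos: "0 < Z"
begin

definition states :: "mstate set" where
  "states = {Load, Rewind, Yes, No} \<union>
     Run ` ({k. set k \<subseteq> instrs q \<and> length k \<le> depth q} \<times>
            {vs. set vs \<subseteq> {..<V} \<and> length vs \<le> depth q})"

lemma finite_states: "finite states"
  unfolding states_def by (intro finite_UnI finite_imageI finite_cartesian_product finite_lists_length_le) auto

definition number :: "mstate \<Rightarrow> nat" where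
  "number = (SOME h. bij_betw h states {0..<card states})"

lemma number_bij: "bij_betw number states {0..<card states}"
  unfolding number_def using someI_ex[OF ex_bij_betw_finite_nat[OF finite_states]] .

lemma number_less: "s \<in> states \<Longrightarrow> number s < card states"
  using number_bij by (auto simp: bij_betw_def)

lemma number_eq_iff: "s \<in> states \<Longrightarrow> s' \<in> states \<Longrightarrow> number s = number s' \<longleftrightarrow> s = s'"
  using number_bij by (auto simp: bij_betw_def inj_on_def)

lemma simple_states [simp]: "Load \<in> states" "Rewind \<in> states" "Yes \<in> states" "No \<in> states"
  by (auto simp: states_def)

text \<open>\<open>Load\<close> copies the input to every tape and puts \<open>Z\<close> behind it,
  \<open>Rewind\<close> brings all heads to the blank in front. From then on all tapes hold the same
  word, which never changes, so that tapes with one head each serve as several pointers into one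
  word.\<close>

fun action :: "mstate \<Rightarrow> nat list \<Rightarrow> mstate \<times> (nat \<times> head_move) list" where
  "action Load xs =
     (if hd xs = 0 then (Rewind, map (\<lambda>x. (Z, Go_Left)) xs)
      else (Load, map (\<lambda>x. (hd xs, Go_Right)) xs))"
| "action Rewind xs =
     (if hd xs = 0 then (Run ([Compute q], []), map (\<lambda>x. (x, Stay)) xs)
      else (Rewind, map (\<lambda>x. (x, Go_Left)) xs))"
| "action (Run c) xs =
     (if fst c = [] then (if hd (snd c) = 0 then No else Yes, map (\<lambda>x. (x, Stay)) xs)
      else (let (c', m) = control_step H (\<lambda>i. if i \<le> H then xs ! i else 0) c
            in (Run c', map (\<lambda>i. (xs ! i, m i)) [0..<Suc H])))"
| "action s xs = (s, map (\<lambda>x. (x, Stay)) xs)"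

text \<open>Well-formedness constrains \<open>delta\<close> also where no run leads, for instance at
  a full stack; results outside the finite set of states are sent to \<open>No\<close>.\<close>

definition machine :: turing_machine where
  "machine =
     \<lparr>num_tapes = Suc H, num_states = card states, num_symbols = Suc Z,
      start_state = number Load, accept_state = number Yes, reject_state = number No,
      delta = \<lambda>n xs. let (s, acts) = action (inv_into states number n) xs
                     in (number (if s \<in> states then s else No), acts)\<rparr>"

lemma machine_simps [simp]:
  "num_tapes machine = Suc H" "num_states machine = card states" "num_symbols machine = Suc Z"
  "start_state machine = number Load" "accept_state machine = number Yes"
  "reject_state machine = number No"
  by (simp_all add: machine_def)

lemma delta_machine:
  assumes "s \<in> states" and "action s xs = (s', acts)" and "s' \<in> states"
  shows "delta machine (number s) xs = (number s', acts)"
  using assms number_bij by (simp add: machine_def bij_betw_inv_into_left)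

lemma action_acts:
  assumes "length xs = Suc H" and "set xs \<subseteq> {..<Suc Z}"
  shows "length (snd (action s xs)) = Suc H" and "fst ` set (snd (action s xs)) \<subseteq> {..<Suc Z}"
proof -
  have hd: "hd xs < Suc Z" using assms hd_in_set[of xs] by (cases xs) auto
  have n: "xs ! i < Suc Z" if "i < Suc H" for i
    using assms that nth_mem[of i xs] by (metis lessThan_iff subsetD)
  show "length (snd (action s xs)) = Suc H"
    using assms by (cases "(s, xs)" rule: action.cases) (auto split: prod.splits)
  show "fst ` set (snd (action s xs)) \<subseteq> {..<Suc Z}"
    using assms hd n by (cases "(s, xs)" rule: action.cases) (auto split: prod.splits)
qed

lemma wf_machine: "wf_tm machine"
  unfolding wf_tm_def
proof (intro conjI allI impI)
  fix n xs assume "n < num_states machine" and xs: "length xs = num_tapes machine \<and> set xs \<subseteq> {..<num_symbols machine}"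
  let ?a = "action (inv_into states number n) xs"
  have d: "delta machine n xs = (number (if fst ?a \<in> states then fst ?a else No), snd ?a)"
    by (simp add: machine_def split: prod.splits)
  show "fst (delta machine n xs) < num_states machine" by (simp add: d number_less)
  show "length (snd (delta machine n xs)) = num_tapes machine"
    using action_acts(1)[of xs] xs by (simp add: d)
  show "fst ` set (snd (delta machine n xs)) \<subseteq> {..<num_symbols machine}"
    using action_acts(2)[of xs] xs unfolding d snd_conv machine_simps by blast
qed (use Z_pos in \<open>auto simp: number_less number_eq_iff\<close>)

end

section \<open>Simulation of a query on a fixed input word\<close>

locale query_run = query_machine +
  fixes w :: "nat list"
  assumes input: "set w \<subseteq> {1..<Z}"
begin

abbreviation sym :: "nat \<Rightarrow> nat" where
  "sym \<equiv> pad_sym Z w"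

lemma sym_eq_0_iff: "sym p = 0 \<longleftrightarrow> p = 0 \<or> length w + 2 \<le> p"
  using pad_sym_eq_0_iff[OF input Z_pos] .

definition conf :: "mstate \<Rightarrow> (nat \<Rightarrow> nat) \<Rightarrow> config" where
  "conf s e = (number s, map (\<lambda>i. (int (e i) - 1, pad_tape Z w)) [0..<Suc H])"

lemma read_conf: "map read_tape (snd (conf s e)) = map (\<lambda>i. sym (e i)) [0..<Suc H]"
  by (simp add: conf_def)

lemma act_unchanged: "act_tape (sym p, d) (int p - 1, pad_tape Z w) = (int p - 1 + offset d, pad_tape Z w)"
proof -
  have "(pad_tape Z w)(int p - 1 := sym p) = pad_tape Z w" by (rule ext) (simp flip: pad_tape_shift)
  then show ?thesis by simp
qed

text \<open>Every symbol is rewritten as it was read, so only the state and the heads change. The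
  moves are compared in \<open>int\<close> to exclude a truncated step to the left of position
  0.\<close>

lemma step_conf:
  assumes "s \<in> states" and "s \<notin> {Yes, No}" and "s' \<in> states"
    and "action s (map (\<lambda>i. sym (e i)) [0..<Suc H]) = (s', map (\<lambda>i. (sym (e i), m i)) [0..<Suc H])"
    and "\<And>i. i \<le> H \<Longrightarrow> int (e' i) = int (e i) + offset (m i)"
  shows "tm_step machine (conf s e) = conf s' e'"
proof -
  have "delta machine (number s) (map read_tape (snd (conf s e))) =
      (number s', map (\<lambda>i. (sym (e i), m i)) [0..<Suc H])"
    unfolding read_conf by (rule delta_machine[OF assms(1,4,3)])
  moreover have "map2 act_tape (map (\<lambda>i. (sym (e i), m i)) [0..<Suc H]) (snd (conf s e)) = snd (conf s' e')"
  proof (rule nth_equalityI)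
    fix i assume "i < length (map2 act_tape (map (\<lambda>i. (sym (e i), m i)) [0..<Suc H]) (snd (conf s e)))"
    then have i: "i < Suc H" by (simp add: conf_def)
    have "map2 act_tape (map (\<lambda>i. (sym (e i), m i)) [0..<Suc H]) (snd (conf s e)) ! i =
        act_tape (sym (e i), m i) (int (e i) - 1, pad_tape Z w)"
      using i by (simp add: conf_def del: upt_Suc act_tape.simps)
    also have "\<dots> = (int (e' i) - 1, pad_tape Z w)"
      unfolding act_unchanged using assms(5)[of i] i by simp
    also have "\<dots> = snd (conf s' e') ! i" using i by (simp add: conf_def del: upt_Suc)
    finally show "map2 act_tape (map (\<lambda>i. (sym (e i), m i)) [0..<Suc H]) (snd (conf s e)) ! i = snd (conf s' e') ! i" .
  qed (simp add: conf_def)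
  moreover have "fst (conf s e) \<noteq> number Yes" "fst (conf s e) \<noteq> number No"
    using assms(1,2) by (auto simp: conf_def number_eq_iff)
  ultimately show ?thesis
    by (cases "conf s e") (auto simp: conf_def)
qed

definition reach :: "nat \<Rightarrow> config \<Rightarrow> config \<Rightarrow> bool" where
  "reach t c c' \<longleftrightarrow> (\<exists>t'\<le>t. (tm_step machine ^^ t') c = c')"

lemma reach_refl: "reach t c c"
  unfolding reach_def by (intro exI[of _ 0]) auto

lemma reach_step: "tm_step machine c = c' \<Longrightarrow> reach 1 c c'"
  unfolding reach_def by (intro exI[of _ 1]) auto

lemma reach_trans: "reach t c c' \<Longrightarrow> reach t' c' c'' \<Longrightarrow> reach (t + t') c c''"
proof -
  assume "reach t c c'" "reach t' c' c''"
  then obtain u u' where "u \<le> t" "(tm_step machine ^^ u) c = c'" "u' \<le> t'" "(tm_step machine ^^ u') c' = c''"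
    unfolding reach_def by blast
  then show ?thesis unfolding reach_def
    by (intro exI[of _ "u' + u"]) (auto simp: funpow_add)
qed

lemma reach_mono: "reach t c c' \<Longrightarrow> t \<le> t' \<Longrightarrow> reach t' c c'"
  unfolding reach_def using order_trans by blast

definition bounded :: "control \<Rightarrow> bool" where
  "bounded c \<longleftrightarrow> set (fst c) \<subseteq> instrs q \<and> length (fst c) \<le> depth q \<and>
     set (snd c) \<subseteq> {..<V} \<and> length (snd c) \<le> depth q"

lemma bounded_iff: "Run c \<in> states \<longleftrightarrow> bounded c"
  by (cases c) (auto simp: states_def bounded_def)

lemma run_step:
  assumes "bounded c" and "fst c \<noteq> []" and "bounded c'"
    and "control_step H (\<lambda>i. if i \<le> H then sym (e i) else 0) c = (c', m)"
    and "\<And>i. i \<le> H \<Longrightarrow> int (e' i) = int (e i) + offset (m i)"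
  shows "reach 1 (conf (Run c) e) (conf (Run c') e')"
proof (rule reach_step, rule step_conf[where m = m])
  have "(\<lambda>i. if i \<le> H then map (\<lambda>i. sym (e i)) [0..<Suc H] ! i else 0) = (\<lambda>i. if i \<le> H then sym (e i) else 0)"
    by (auto simp del: upt_Suc)
  then show "action (Run c) (map (\<lambda>i. sym (e i)) [0..<Suc H]) = (Run c', map (\<lambda>i. (sym (e i), m i)) [0..<Suc H])"
    using assms(2,4) by (auto simp del: upt_Suc)
qed (use assms in \<open>auto simp: bounded_iff\<close>)

definition scanned :: "(nat \<Rightarrow> nat) \<Rightarrow> head_move \<Rightarrow> nat \<Rightarrow> nat \<Rightarrow> nat \<Rightarrow> nat \<Rightarrow> nat" where
  "scanned e d i j n = (\<lambda>x. if x = H then n else if x = i \<or> x = j then shift d n (e x) else e x)"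

lemma reach_scan:
  assumes wf: "wf_query V H n (Scan d C r i j)" and e: "\<And>i. i < H \<Longrightarrow> e i < length w + 2" "e H = 0"
    and k: "instrs (Scan d C r i j) \<subseteq> instrs q" "set k \<subseteq> instrs q" "length k + 2 \<le> depth q"
    and vs: "set vs \<subseteq> {..<V}" "length vs + 2 \<le> depth q"
  shows "reach (2 * length w + 6) (conf (Run (Compute (Scan d C r i j) # k, vs)) e)
      (conf (Run (k, query_value Z w e (Scan d C r i j) # vs)) e)"
proof -
  define N where "N = scan_len Z w d C (e i) (e j)"
  define v where "v = query_value Z w e (Scan d C r i j)"
  have v: "v < V" using query_value_less[OF wf] by (simp add: v_def)
  have C: "x \<noteq> 0" "y \<noteq> 0" if "C b x y" for b x y using wf that by auto
  have ij: "i < H" "j < H" and d: "d \<noteq> Stay" using wf by auto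
  have N: "N \<le> length w + 1" unfolding N_def using C d e(1)[OF ij(1)] by (intro scan_len_le) auto
  have v_eq: "v = r (sym (shift d N (e i))) (sym (shift d N (e j)))"
    by (simp add: v_def N_def Let_def)
  \<comment> \<open>A scan continues on nonblank symbols only, hence not from position 0; so no move
    to the left is truncated, and every move can be undone.\<close>
  have pos: "0 < shift d m (e i)" "0 < shift d m (e j)" if "m < N" for m
    using C[OF scan_len_continue[of m Z w d C "e i" "e j"]] that by (auto simp: N_def sym_eq_0_iff)
  have move: "int (shift d (Suc m) (e x)) = int (shift d m (e x)) + offset d"
      "int (shift d m (e x)) = int (shift d (Suc m) (e x)) + offset (opposite d)"
    if "m < N" "x = i \<or> x = j" for m x
    using pos[OF that(1)] that(2) d by (cases d; auto)+
  have b: "bounded (Go b d C r i j # k, vs)" "bounded (Compute (Scan d C r i j) # k, vs)"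
      "bounded (Return d i j # k, v # vs)" "bounded (k, v # vs)" for b
    using k vs v by (cases b; auto simp: bounded_def)+
  have start: "reach 1 (conf (Run (Compute (Scan d C r i j) # k, vs)) e) (conf (Run (Go True d C r i j # k, vs)) e)"
    by (rule run_step) (auto simp: b)
  have go: "reach m (conf (Run (Go True d C r i j # k, vs)) e)
      (conf (Run (Go (m = 0) d C r i j # k, vs)) (scanned e d i j m))" if "m \<le> N" for m
    using that
  proof (induction m)
    case 0
    have "scanned e d i j 0 = e" using e(2) by (cases d) (auto simp: scanned_def)
    then show ?case by (simp add: reach_refl)
  next
    case (Suc m)
    have "reach 1 (conf (Run (Go (m = 0) d C r i j # k, vs)) (scanned e d i j m))
        (conf (Run (Go False d C r i j # k, vs)) (scanned e d i j (Suc m)))"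
      using scan_len_continue[of m Z w d C "e i" "e j"] ij Suc.prems move(1)[of m]
      by (intro run_step[OF b(1) _ b(1)]) (auto simp: scanned_def N_def)
    with Suc show ?case using reach_trans[of m _ _ 1] by fastforce
  qed
  have turn: "reach 1 (conf (Run (Go (N = 0) d C r i j # k, vs)) (scanned e d i j N))
      (conf (Run (Return d i j # k, v # vs)) (scanned e d i j N))"
    using scan_len_stop[OF C(1) d e(1)[OF ij(1)] N_def] ij
    by (intro run_step[OF b(1) _ b(3)]) (auto simp: scanned_def v_eq)
  \<comment> \<open>As \<open>m \<le> N \<le> length w + 1\<close>, the counter head reads the blank
    only at 0; the pointers thus move back exactly as far as they came.\<close>
  have return: "reach (m + 1) (conf (Run (Return d i j # k, v # vs)) (scanned e d i j m))
      (conf (Run (k, v # vs)) e)" if "m \<le> N" for m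
    using that
  proof (induction m)
    case 0
    have "scanned e d i j 0 = e" using e(2) by (cases d) (auto simp: scanned_def)
    moreover have "reach 1 (conf (Run (Return d i j # k, v # vs)) e) (conf (Run (k, v # vs)) e)"
      using e(2) by (intro run_step[OF b(3) _ b(4)]) auto
    ultimately show ?case by simp
  next
    case (Suc m)
    have "reach 1 (conf (Run (Return d i j # k, v # vs)) (scanned e d i j (Suc m)))
        (conf (Run (Return d i j # k, v # vs)) (scanned e d i j m))"
      using ij Suc.prems move(2)[of m] N
      by (intro run_step[OF b(3) _ b(3)]) (auto simp: scanned_def sym_eq_0_iff)
    with Suc show ?case using reach_trans[of 1 _ _ "m + 1"] by fastforce
  qed
  have "reach (1 + (N + (1 + (N + 1)))) (conf (Run (Compute (Scan d C r i j) # k, vs)) e)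
      (conf (Run (k, v # vs)) e)"
    by (intro reach_trans[OF start] reach_trans[OF go] reach_trans[OF turn] return) auto
  then show ?thesis unfolding v_def by (rule reach_mono) (use N in simp)
qed

end

context query_run
begin

text \<open>\<open>Test\<close> has already stepped back from the blank behind the word; on that
  blank \<open>Rew\<close> would stop immediately.\<close>

lemma reach_Rew:
  assumes "Rew i \<in> instrs q" "set k \<subseteq> instrs q" "length k < depth q" "set vs \<subseteq> {..<V}" "length vs \<le> depth q"
    and "i < H" "m < length w + 2"
  shows "reach (m + 1) (conf (Run (Rew i # k, vs)) (e(i := m))) (conf (Run (k, vs)) (e(i := 0)))"
  using assms(7)
proof (induction m)
  case 0
  have "reach 1 (conf (Run (Rew i # k, vs)) (e(i := 0))) (conf (Run (k, vs)) (e(i := 0)))"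
    using assms(1-6) by (intro run_step) (auto simp: bounded_def)
  then show ?case by (simp add: fun_upd_def)
next
  case (Suc m)
  have "reach 1 (conf (Run (Rew i # k, vs)) (e(i := Suc m))) (conf (Run (Rew i # k, vs)) (e(i := m)))"
    using assms(1-6) Suc.prems
    by (intro run_step[where m = "\<lambda>x. if x = i then Go_Left else Stay"]) (auto simp: bounded_def sym_eq_0_iff)
  from reach_trans[OF this Suc.IH] Suc.prems show ?case by (simp add: fun_upd_def)
qed

text \<open>The pointers not yet bound and the counter rest at position 0, and \<open>e\<close> is
  restored at the end. This makes subqueries composable and lets an inner fold start from 0 in every
  round.\<close>

lemma reach_Compute:
  assumes "wf_query V H n q'" and "\<And>i. n \<le> i \<Longrightarrow> i \<le> H \<Longrightarrow> e i = 0" and "e H = 0"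
    and "\<And>i. i < H \<Longrightarrow> e i < length w + 2"
    and "instrs q' \<subseteq> instrs q" "set k \<subseteq> instrs q" "length k + depth q' \<le> depth q"
    and "set vs \<subseteq> {..<V}" "length vs + depth q' \<le> depth q"
  shows "reach (poly (time_poly q') (length w)) (conf (Run (Compute q' # k, vs)) e)
      (conf (Run (k, query_value Z w e q' # vs)) e)"
  using assms
proof (induction q' arbitrary: n e k vs)
  case (Scan d C r i j)
  then show ?case using reach_scan[of n d C r i j e k vs] by (simp add: algebra_simps)
next
  case (App F q1 q2)
  let ?v1 = "query_value Z w e q1" and ?v2 = "query_value Z w e q2"
  have v: "?v1 < V" "?v2 < V" "F ?v1 ?v2 < V" using App.prems(1) query_value_less by auto
  have "reach 1 (conf (Run (Compute (App F q1 q2) # k, vs)) e)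
      (conf (Run (Compute q1 # Compute q2 # Comb F # k, vs)) e)"
    using App.prems depth_pos[of q1] by (intro run_step) (auto simp: bounded_def)
  moreover have "reach (poly (time_poly q1) (length w))
      (conf (Run (Compute q1 # Compute q2 # Comb F # k, vs)) e)
      (conf (Run (Compute q2 # Comb F # k, ?v1 # vs)) e)"
    using App.prems by (intro App.IH(1)) auto
  moreover have "reach (poly (time_poly q2) (length w))
      (conf (Run (Compute q2 # Comb F # k, ?v1 # vs)) e)
      (conf (Run (Comb F # k, ?v2 # ?v1 # vs)) e)"
    using App.prems v by (intro App.IH(2)) auto
  moreover have "reach 1 (conf (Run (Comb F # k, ?v2 # ?v1 # vs)) e)
      (conf (Run (k, F ?v1 ?v2 # vs)) e)"
    using App.prems v by (intro run_step) (auto simp: bounded_def)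
  ultimately have "reach (1 + (poly (time_poly q1) (length w) + (poly (time_poly q2) (length w) + 1)))
      (conf (Run (Compute (App F q1 q2) # k, vs)) e) (conf (Run (k, F ?v1 ?v2 # vs)) e)"
    by (blast intro: reach_trans)
  then show ?case by (simp add: algebra_simps)
next
  case (Fold i F a q1)
  let ?N = "length w + 2" and ?t = "poly (time_poly q1) (length w)"
  define f where "f x p = F x (query_value Z w (e(i := p)) q1)" for x p
  have i: "n \<le> i" "i < H" "a < V" and F: "\<And>x y. F x y < V" and wf1: "wf_query V H (Suc i) q1"
    using Fold.prems(1) by auto
  have e_i: "e(i := 0) = e" using Fold.prems(2)[of i] i by auto
  \<comment> \<open>\<open>l\<close> counts the rounds after the present one. In the last round
    \<open>Next\<close> runs onto the blank behind \<open>Z\<close> and \<open>Test\<close> steps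
    back, so the loop ends at position \<open>length w + 1\<close>.\<close>
  have loop: "reach (Suc l * (?t + 3))
      (conf (Run (Compute q1 # Comb F # Next i F q1 # k, x # vs)) (e(i := p)))
      (conf (Run (Rew i # k, foldl f x [p..<?N] # vs)) (e(i := length w + 1)))"
    if "Suc l + p = ?N" "x < V" for l p x
    using that
  proof (induction l arbitrary: p x)
    case 0
    then have p: "p = length w + 1" by simp
    have f: "foldl f x [p..<?N] = f x p" by (simp add: p)
    have "reach ?t (conf (Run (Compute q1 # Comb F # Next i F q1 # k, x # vs)) (e(i := p)))
        (conf (Run (Comb F # Next i F q1 # k, query_value Z w (e(i := p)) q1 # x # vs)) (e(i := p)))"
      using Fold.prems i 0 by (intro Fold.IH[OF wf1]) auto
    moreover have "reach 1 (conf (Run (Comb F # Next i F q1 # k, query_value Z w (e(i := p)) q1 # x # vs)) (e(i := p)))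
        (conf (Run (Next i F q1 # k, f x p # vs)) (e(i := p)))"
      using Fold.prems F 0 query_value_less[OF wf1] by (intro run_step) (auto simp: bounded_def f_def)
    moreover have "reach 1 (conf (Run (Next i F q1 # k, f x p # vs)) (e(i := p)))
        (conf (Run (Test i F q1 # k, f x p # vs)) (e(i := Suc p)))"
      using Fold.prems F i
      by (intro run_step[where m = "\<lambda>x. if x = i then Go_Right else Stay"]) (auto simp: bounded_def f_def)
    moreover have "reach 1 (conf (Run (Test i F q1 # k, f x p # vs)) (e(i := Suc p)))
        (conf (Run (Rew i # k, f x p # vs)) (e(i := p)))"
      using Fold.prems F i p
      by (intro run_step[where m = "\<lambda>x. if x = i then Go_Left else Stay"])
        (auto simp: bounded_def f_def pad_sym_beyond)
    ultimately have "reach (?t + (1 + (1 + 1)))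
        (conf (Run (Compute q1 # Comb F # Next i F q1 # k, x # vs)) (e(i := p)))
        (conf (Run (Rew i # k, f x p # vs)) (e(i := p)))"
      by (blast intro: reach_trans)
    then show ?case unfolding f using p by (simp add: numeral_3_eq_3 fun_upd_def)
  next
    case (Suc l)
    then have p: "p < length w + 1" by simp
    have f: "foldl f x [p..<?N] = foldl f (f x p) [Suc p..<?N]" using p by (simp add: upt_conv_Cons del: upt_Suc)
    have "reach ?t (conf (Run (Compute q1 # Comb F # Next i F q1 # k, x # vs)) (e(i := p)))
        (conf (Run (Comb F # Next i F q1 # k, query_value Z w (e(i := p)) q1 # x # vs)) (e(i := p)))"
      using Fold.prems i p Suc.prems by (intro Fold.IH[OF wf1]) auto
    moreover have "reach 1 (conf (Run (Comb F # Next i F q1 # k, query_value Z w (e(i := p)) q1 # x # vs)) (e(i := p)))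
        (conf (Run (Next i F q1 # k, f x p # vs)) (e(i := p)))"
      using Fold.prems F Suc.prems query_value_less[OF wf1] by (intro run_step) (auto simp: bounded_def f_def)
    moreover have "reach 1 (conf (Run (Next i F q1 # k, f x p # vs)) (e(i := p)))
        (conf (Run (Test i F q1 # k, f x p # vs)) (e(i := Suc p)))"
      using Fold.prems F i
      by (intro run_step[where m = "\<lambda>x. if x = i then Go_Right else Stay"]) (auto simp: bounded_def f_def)
    moreover have "reach 1 (conf (Run (Test i F q1 # k, f x p # vs)) (e(i := Suc p)))
        (conf (Run (Compute q1 # Comb F # Next i F q1 # k, f x p # vs)) (e(i := Suc p)))"
      using Fold.prems F i p
      by (intro run_step[where m = "\<lambda>x. Stay"]) (auto simp: bounded_def f_def sym_eq_0_iff)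
    moreover have "reach (Suc l * (?t + 3))
        (conf (Run (Compute q1 # Comb F # Next i F q1 # k, f x p # vs)) (e(i := Suc p)))
        (conf (Run (Rew i # k, foldl f (f x p) [Suc p..<?N] # vs)) (e(i := length w + 1)))"
      using Suc.prems F by (intro Suc.IH) (auto simp: f_def)
    ultimately have "reach (?t + (1 + (1 + (1 + Suc l * (?t + 3)))))
        (conf (Run (Compute q1 # Comb F # Next i F q1 # k, x # vs)) (e(i := p)))
        (conf (Run (Rew i # k, foldl f (f x p) [Suc p..<?N] # vs)) (e(i := length w + 1)))"
      by (blast intro: reach_trans)
    then show ?case unfolding f by (rule reach_mono) (simp add: algebra_simps)
  qed
  let ?v = "foldl f a [0..<?N]"
  have v: "?v < V" using foldl_closed[of a "{..<V}" _ f] i F by (auto simp: f_def)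
  have "reach 1 (conf (Run (Compute (Fold i F a q1) # k, vs)) e)
      (conf (Run (Compute q1 # Comb F # Next i F q1 # k, a # vs)) e)"
    using Fold.prems i by (intro run_step) (auto simp: bounded_def)
  moreover have "reach (?N * (?t + 3)) (conf (Run (Compute q1 # Comb F # Next i F q1 # k, a # vs)) e)
      (conf (Run (Rew i # k, ?v # vs)) (e(i := length w + 1)))"
    using loop[of "length w + 1" 0 a] i unfolding e_i by simp
  moreover have "reach (length w + 1 + 1) (conf (Run (Rew i # k, ?v # vs)) (e(i := length w + 1)))
      (conf (Run (k, ?v # vs)) e)"
    using reach_Rew[of i k "?v # vs" "length w + 1" e] Fold.prems v i unfolding e_i by auto
  ultimately have "reach (1 + (?N * (?t + 3) + (length w + 1 + 1)))
      (conf (Run (Compute (Fold i F a q1) # k, vs)) e) (conf (Run (k, ?v # vs)) e)"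
    by (blast intro: reach_trans)
  moreover have "query_value Z w e (Fold i F a q1) = ?v" unfolding f_def by simp
  ultimately show ?case by (simp add: algebra_simps)
qed

section \<open>Loading the input and giving the answer\<close>

definition load_conf :: "nat \<Rightarrow> config" where
  "load_conf t = (number Load, map (\<lambda>i. (int t,
     \<lambda>z. if 0 \<le> z \<and> z < (if i = 0 then int (length w) else int t) then w ! nat z else 0)) [0..<Suc H])"

lemma load_step:
  assumes "t < length w"
  shows "tm_step machine (load_conf t) = load_conf (Suc t)"
proof -
  let ?xs = "map read_tape (snd (load_conf t))"
  have hd: "hd ?xs = w ! t" using assms by (simp add: load_conf_def hd_map upt_rec[of 0])
  have nz: "w ! t \<noteq> 0" using input nth_mem[OF assms] by auto
  have len: "length ?xs = Suc H" by (simp add: load_conf_def)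
  have d: "delta machine (number Load) ?xs = (number Load, replicate (Suc H) (w ! t, Go_Right))"
    using hd nz len by (intro delta_machine) (auto simp: map_replicate_const)
  have "map2 act_tape (replicate (Suc H) (w ! t, Go_Right)) (snd (load_conf t)) = snd (load_conf (Suc t))"
  proof (rule nth_equalityI)
    fix i assume "i < length (map2 act_tape (replicate (Suc H) (w ! t, Go_Right)) (snd (load_conf t)))"
    then have i: "i < Suc H" by (simp add: load_conf_def)
    then show "map2 act_tape (replicate (Suc H) (w ! t, Go_Right)) (snd (load_conf t)) ! i = snd (load_conf (Suc t)) ! i"
      using assms by (auto simp: load_conf_def fun_eq_iff simp del: upt_Suc replicate_Suc)
  qed (simp add: load_conf_def)
  with d show ?thesis
    by (cases "load_conf t") (auto simp: load_conf_def number_eq_iff)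
qed

text \<open>\<open>Z\<close> is written into cell \<open>length w\<close>; the move to the left then
  leads to cell \<open>length w - 1\<close>, which is position \<open>length w\<close>.\<close>

lemma load_end: "tm_step machine (load_conf (length w)) = conf Rewind (\<lambda>_. length w)"
proof -
  let ?xs = "map read_tape (snd (load_conf (length w)))"
  have hd: "hd ?xs = 0" by (simp add: load_conf_def hd_map upt_rec[of 0])
  have len: "length ?xs = Suc H" by (simp add: load_conf_def)
  have d: "delta machine (number Load) ?xs = (number Rewind, replicate (Suc H) (Z, Go_Left))"
    using hd len by (intro delta_machine) (auto simp: map_replicate_const)
  have tape: "(\<lambda>z. if 0 \<le> z \<and> z < int (length w) then w ! nat z else 0)(int (length w) := Z) = pad_tape Z w"
    by (auto simp: fun_eq_iff pad_tape_def pad_sym_def padded_def nth_append)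
  have "map2 act_tape (replicate (Suc H) (Z, Go_Left)) (snd (load_conf (length w))) = snd (conf Rewind (\<lambda>_. length w))"
  proof (rule nth_equalityI)
    fix i assume "i < length (map2 act_tape (replicate (Suc H) (Z, Go_Left)) (snd (load_conf (length w))))"
    then have i: "i < Suc H" by (simp add: load_conf_def)
    then show "map2 act_tape (replicate (Suc H) (Z, Go_Left)) (snd (load_conf (length w))) ! i = snd (conf Rewind (\<lambda>_. length w)) ! i"
      using tape by (simp add: load_conf_def conf_def del: upt_Suc replicate_Suc)
  qed (simp add: load_conf_def conf_def)
  with d show ?thesis
    by (cases "load_conf (length w)") (auto simp: load_conf_def conf_def number_eq_iff)
qed

lemma reach_Rewind:
  "p < length w + 2 \<Longrightarrow> reach (p + 1) (conf Rewind (\<lambda>_. p)) (conf (Run ([Compute q], [])) (\<lambda>_. 0))"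
proof (induction p)
  case 0
  have "Run ([Compute q], []) \<in> states"
    using depth_pos[of q] by (auto simp: states_def)
  then have "tm_step machine (conf Rewind (\<lambda>_. 0)) = conf (Run ([Compute q], [])) (\<lambda>_. 0)"
    by (intro step_conf[where m = "\<lambda>_. Stay"]) (auto simp: hd_map upt_rec[of 0] simp del: upt_Suc)
  from reach_step[OF this] show ?case by simp
next
  case (Suc p)
  have "tm_step machine (conf Rewind (\<lambda>_. Suc p)) = conf Rewind (\<lambda>_. p)"
    using Suc.prems
    by (intro step_conf[where m = "\<lambda>_. Go_Left"]) (auto simp: hd_map upt_rec[of 0] sym_eq_0_iff simp del: upt_Suc)
  with Suc show ?case using reach_trans[OF reach_step, of _ _ "p + 1"] by fastforce
qed

lemma reach_answer:
  "reach (poly ([:4, 2:] + time_poly q) (length w)) (initial_config machine w)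
     (conf (if query_value Z w (\<lambda>_. 0) q = 0 then No else Yes) (\<lambda>_. 0))"
proof -
  let ?v = "query_value Z w (\<lambda>_. 0) q"
  have init: "initial_config machine w = load_conf 0"
  proof -
    have "snd (initial_config machine w) = snd (load_conf 0)"
      by (rule nth_equalityI) (auto simp: initial_config_def load_conf_def nth_Cons fun_eq_iff simp del: upt_Suc split: nat.splits)
    then show ?thesis by (simp add: initial_config_def load_conf_def prod_eq_iff)
  qed
  have load: "reach t (load_conf 0) (load_conf t)" if "t \<le> length w" for t
    using that
  proof (induction t)
    case (Suc t)
    then show ?case using reach_trans[OF Suc.IH reach_step[OF load_step]] by auto
  qed (rule reach_refl)
  note load[OF order_refl]
  moreover have "reach 1 (load_conf (length w)) (conf Rewind (\<lambda>_. length w))"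
    by (rule reach_step[OF load_end])
  moreover have "reach (length w + 1) (conf Rewind (\<lambda>_. length w)) (conf (Run ([Compute q], [])) (\<lambda>_. 0))"
    by (rule reach_Rewind) simp
  moreover have "reach (poly (time_poly q) (length w)) (conf (Run ([Compute q], [])) (\<lambda>_. 0)) (conf (Run ([], [?v])) (\<lambda>_. 0))"
    using wf depth_pos[of q] by (intro reach_Compute[of 0]) auto
  moreover have "tm_step machine (conf (Run ([], [?v])) (\<lambda>_. 0)) = conf (if ?v = 0 then No else Yes) (\<lambda>_. 0)"
    using query_value_less[OF wf] depth_pos[of q]
    by (intro step_conf[where m = "\<lambda>_. Stay"]) (auto simp: states_def simp del: upt_Suc)
  ultimately have "reach (length w + (1 + (length w + 1 + (poly (time_poly q) (length w) + 1))))
      (load_conf 0) (conf (if ?v = 0 then No else Yes) (\<lambda>_. 0))"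
    by (blast intro: reach_trans reach_step)
  then show ?thesis unfolding init by (rule reach_mono) (simp add: algebra_simps)
qed

end

theorem query_decidable:
  assumes "wf_query V H 0 q" and "0 < Z"
  obtains M p where "wf_tm M" and
    "\<And>w. set w \<subseteq> {1..<Z} \<Longrightarrow>
       answers_within M w (query_value Z w (\<lambda>_. 0) q \<noteq> 0) (poly p (length w))"
proof -
  interpret query_machine Z V H q using assms by unfold_locales
  show ?thesis
  proof (rule that[OF wf_machine, of "[:4, 2:] + time_poly q"])
    fix w :: "nat list" assume w: "set w \<subseteq> {1..<Z}"
    interpret query_run Z V H q w using w by unfold_locales
    show "answers_within machine w (query_value Z w (\<lambda>_. 0) q \<noteq> 0) (poly ([:4, 2:] + time_poly q) (length w))"
      using reach_answer w unfolding answers_within_def reach_def by (fastforce simp: conf_def)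
  qed
qed

section \<open>Definable functions\<close>

definition valid :: "nat \<Rightarrow> nat list \<Rightarrow> (nat \<Rightarrow> nat) \<Rightarrow> bool" where
  "valid Z w e \<longleftrightarrow> 0 < Z \<and> set w \<subseteq> {1..<Z} \<and> (\<forall>i. e i < length w + 2)"

text \<open>Factoring through a query forces finitely many values on valid arguments, but these may
  have any type, even a function type. Pointers bound in the query are numbered from
  \<open>n\<close> on, which leaves those below \<open>n\<close> for arguments.\<close>

definition definable :: "nat \<Rightarrow> nat \<Rightarrow> (nat list \<Rightarrow> (nat \<Rightarrow> nat) \<Rightarrow> 'v) \<Rightarrow> bool" where
  "definable Z n \<Phi> \<longleftrightarrow>
     (\<exists>V H q dec. wf_query V H n q \<and> (\<forall>w e. valid Z w e \<longrightarrow> \<Phi> w e = dec (query_value Z w e q)))"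

lemma definableI:
  assumes "wf_query V H n q" and "\<And>w e. valid Z w e \<Longrightarrow> \<Phi> w e = dec (query_value Z w e q)"
  shows "definable Z n \<Phi>"
  using assms unfolding definable_def by blast

lemma definable_cong:
  assumes "definable Z n \<Phi>" and "\<And>w e. valid Z w e \<Longrightarrow> \<Phi> w e = \<Psi> w e"
  shows "definable Z n \<Psi>"
proof -
  obtain V H q dec where "wf_query V H n q" "\<And>w e. valid Z w e \<Longrightarrow> \<Phi> w e = dec (query_value Z w e q)"
    using assms(1) unfolding definable_def by blast
  with assms(2) show ?thesis by (intro definableI[where dec = dec]) auto
qed

lemma definable_const: "definable Z n (\<lambda>w e. c)"
  by (rule definableI[where V = 1 and H = 1 and q = "Scan Go_Right (\<lambda>_ _ _. False) (\<lambda>_ _. 0) 0 0" and dec = "\<lambda>_. c"]) auto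

lemma definable_sym: "definable Z n (\<lambda>w e. pad_sym Z w (e i))"
proof (rule definableI[where dec = id])
  \<comment> \<open>The minimum with \<open>Z\<close> changes no symbol of the padded word; it
    bounds the result on all arguments, as well-formedness demands.\<close>
  show "wf_query (Suc Z) (Suc i) n (Scan Go_Right (\<lambda>_ _ _. False) (\<lambda>x y. min x Z) i i)" by (simp add: less_Suc_eq_le)
  fix w e assume v: "valid Z w e"
  have "pad_sym Z w p \<le> Z" for p
  proof (cases "p < length w + 2")
    case True
    then have "padded Z w ! p \<in> set (padded Z w)" by (intro nth_mem) (simp add: padded_def)
    also have "\<dots> \<subseteq> {..Z}" using v by (auto simp: padded_def valid_def)
    finally show ?thesis by (simp add: pad_sym_def)
  qed (simp add: pad_sym_def)
  then show "pad_sym Z w (e i) = id (query_value Z w e (Scan Go_Right (\<lambda>_ _ _. False) (\<lambda>x y. min x Z) i i))"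
    by (simp add: scan_len_def Let_def min_absorb1)
qed

lemma definable_map2:
  assumes "definable Z n \<Phi>" and "definable Z n \<Psi>"
  shows "definable Z n (\<lambda>w e. F (\<Phi> w e) (\<Psi> w e))"
proof -
  obtain V H q dec where 1: "wf_query V H n q" "\<And>w e. valid Z w e \<Longrightarrow> \<Phi> w e = dec (query_value Z w e q)"
    using assms(1) unfolding definable_def by blast
  obtain V' H' q' dec' where 2: "wf_query V' H' n q'" "\<And>w e. valid Z w e \<Longrightarrow> \<Psi> w e = dec' (query_value Z w e q')"
    using assms(2) unfolding definable_def by blast
  \<comment> \<open>Both codes are below \<open>U\<close>, so a pair can be coded as
    \<open>x * U + y\<close> and split again by \<open>div\<close> and \<open>mod\<close>.\<close>
  define U where "U = max V V'"
  define pair where "pair x y = (if x < U \<and> y < U then x * U + y else 0)" for x y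
  have U: "0 < U" using query_value_less[OF 1(1)] by (auto simp: U_def less_max_iff_disj intro: le_less_trans)
  have "pair x y < U * U" for x y
  proof (cases "x < U \<and> y < U")
    case True
    then have "x * U + y < Suc x * U" by simp
    also have "\<dots> \<le> U * U" using True by (intro mult_right_mono) auto
    finally show ?thesis using True by (simp add: pair_def)
  qed (use U in \<open>auto simp: pair_def\<close>)
  then have "wf_query (U * U) (max H H') n (App pair q q')"
    using wf_query_mono[OF 1(1), of "U * U" "max H H'" n] wf_query_mono[OF 2(1), of "U * U" "max H H'" n]
      le_trans[OF _ le_square[of U]] by (auto simp: U_def)
  moreover have "F (\<Phi> w e) (\<Psi> w e) =
      (\<lambda>v. F (dec (v div U)) (dec' (v mod U))) (query_value Z w e (App pair q q'))" if "valid Z w e" for w e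
    using query_value_less[OF 1(1), of Z w e] query_value_less[OF 2(1), of Z w e] U
    by (simp add: pair_def U_def less_max_iff_disj 1(2)[OF that] 2(2)[OF that])
  ultimately show ?thesis by (rule definableI)
qed

lemma definable_map: "definable Z n \<Phi> \<Longrightarrow> definable Z n (\<lambda>w e. F (\<Phi> w e))"
  using definable_map2[of Z n \<Phi> \<Phi> "\<lambda>x y. F x"] by simp

text \<open>The machine folds over numbers, so the accumulator may have any type as long as it stays
  in a finite set \<open>A\<close>; \<open>g\<close> is the step transported along a numbering of
  \<open>A\<close>.\<close>

lemma definable_foldl:
  assumes \<Phi>: "definable Z (Suc n) \<Phi>" and A: "finite A" "a \<in> A"
    and Y: "\<And>w e. valid Z w e \<Longrightarrow> \<Phi> w e \<in> Y" and F: "\<And>x y. x \<in> A \<Longrightarrow> y \<in> Y \<Longrightarrow> F x y \<in> A"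
  shows "definable Z n (\<lambda>w e. foldl (\<lambda>x p. F x (\<Phi> w (e(n := p)))) a [0..<length w + 2])"
proof -
  obtain V H q dec where q: "wf_query V H (Suc n) q"
    "\<And>w e. valid Z w e \<Longrightarrow> \<Phi> w e = dec (query_value Z w e q)"
    using \<Phi> unfolding definable_def by blast
  obtain h where h: "bij_betw h A {0..<card A}" using ex_bij_betw_finite_nat[OF A(1)] by blast
  define U where "U = max V (card A)"
  define g where "g x v = (if F (inv_into A h x) (dec v) \<in> A then h (F (inv_into A h x) (dec v)) else 0)" for x v
  have hA: "h x < card A" if "x \<in> A" for x using h that by (auto simp: bij_betw_def)
  have card: "0 < card A" using A by (auto simp: card_gt_0_iff)
  have "g x v < U" for x v using hA card by (auto simp: g_def U_def less_max_iff_disj)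
  then have "wf_query U (max H (Suc n)) n (Fold n g (h a) q)"
    using wf_query_mono[OF q(1), of U "max H (Suc n)" "Suc n"] hA[OF A(2)] by (auto simp: U_def)
  moreover have "foldl (\<lambda>x p. F x (\<Phi> w (e(n := p)))) a [0..<length w + 2] =
      inv_into A h (query_value Z w e (Fold n g (h a) q))" if v: "valid Z w e" for w e
  proof -
    have fold_eq: "foldl (\<lambda>x p. F x (\<Phi> w (e(n := p)))) b ps =
        inv_into A h (foldl (\<lambda>x p. g x (query_value Z w (e(n := p)) q)) (h b) ps)"
      if "b \<in> A" "set ps \<subseteq> {..<length w + 2}" for b ps
      using that
    proof (induction ps arbitrary: b)
      case Nil
      then show ?case using h by (simp add: bij_betw_inv_into_left)
    next
      case (Cons p ps)
      have v': "valid Z w (e(n := p))" using v Cons.prems by (auto simp: valid_def)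
      have "F b (\<Phi> w (e(n := p))) \<in> A" using F Y[OF v'] Cons.prems by blast
      moreover from this have "g (h b) (query_value Z w (e(n := p)) q) = h (F b (\<Phi> w (e(n := p))))"
        using h Cons.prems by (simp add: g_def bij_betw_inv_into_left flip: q(2)[OF v'])
      ultimately show ?case using Cons by (simp del: fun_upd_apply)
    qed
    show ?thesis unfolding query_value.simps by (rule fold_eq[OF A(2)]) (auto simp del: upt_Suc)
  qed
  ultimately show ?thesis by (rule definableI)
qed

lemma foldl_plus_upt:
  "foldl (\<lambda>x p. x + f p) a [0..<n] = a + (\<Sum>p<n. f p)" for f :: "nat \<Rightarrow> 'b::comm_monoid_add"
  by (induction n) (auto simp: ac_simps)

lemma definable_sum:
  fixes \<Phi> :: "nat list \<Rightarrow> (nat \<Rightarrow> nat) \<Rightarrow> 'b::{comm_monoid_add,finite}"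
  assumes "definable Z (Suc n) \<Phi>"
  shows "definable Z n (\<lambda>w e. \<Sum>p<length w + 2. \<Phi> w (e(n := p)))"
  using definable_foldl[OF assms, of UNIV 0 UNIV "(+)"] by (simp only: foldl_plus_upt) simp

lemma foldl_times_upt:
  "foldl (\<lambda>x p. x * f p) a [0..<n] = a * (\<Prod>p<n. f p)" for f :: "nat \<Rightarrow> 'b::comm_monoid_mult"
  by (induction n) (auto simp: ac_simps)

lemma definable_prod:
  fixes \<Phi> :: "nat list \<Rightarrow> (nat \<Rightarrow> nat) \<Rightarrow> 'b::{comm_monoid_mult,finite}"
  assumes "definable Z (Suc n) \<Phi>"
  shows "definable Z n (\<lambda>w e. \<Prod>p<length w + 2. \<Phi> w (e(n := p)))"
  using definable_foldl[OF assms, of UNIV 1 UNIV "(*)"] by (simp only: foldl_times_upt) simp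

text \<open>The accumulator is a whole function here. Closure of \<open>B\<close> under pointwise
  products keeps it in a finite set although \<open>'g\<close> may be infinite.\<close>

lemma definable_prod_fun:
  fixes \<Phi> :: "nat list \<Rightarrow> (nat \<Rightarrow> nat) \<Rightarrow> 'g \<Rightarrow> 'b::comm_monoid_mult"
  assumes "definable Z (Suc n) \<Phi>" and "finite B" and "(\<lambda>_. 1) \<in> B"
    and "\<And>w e. \<Phi> w e \<in> B" and "\<And>h h'. h \<in> B \<Longrightarrow> h' \<in> B \<Longrightarrow> (\<lambda>g. h g * h' g) \<in> B"
  shows "definable Z n (\<lambda>w e g. \<Prod>p<length w + 2. \<Phi> w (e(n := p)) g)"
proof -
  have eq: "foldl (\<lambda>h p g. h g * f p g) h [0..<m] = (\<lambda>g. h g * (\<Prod>p<m. f p g))" for f :: "nat \<Rightarrow> 'g \<Rightarrow> 'b" and h m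
    by (induction m) (auto simp: ac_simps)
  show ?thesis
    using definable_foldl[OF assms(1-3), of B "\<lambda>h h' g. h g * h' g"] assms(4,5)
    by (simp only: eq) simp
qed

lemma definable_ex:
  assumes "definable Z (Suc n) \<Phi>"
  shows "definable Z n (\<lambda>w e. \<exists>p<length w + 2. \<Phi> w (e(n := p)))"
proof -
  have eq: "foldl (\<lambda>x p. x \<or> f p) a [0..<m] = (a \<or> (\<exists>p<m. f p))" for f a m
    by (induction m) (auto simp: less_Suc_eq)
  show ?thesis using definable_foldl[OF assms, of UNIV False UNIV "(\<or>)"] by (simp only: eq) simp
qed

lemma definable_all:
  assumes "definable Z (Suc n) \<Phi>"
  shows "definable Z n (\<lambda>w e. \<forall>p<length w + 2. \<Phi> w (e(n := p)))"
  using definable_map[OF definable_ex[OF definable_map[OF assms, of Not]], of Not] by simp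

text \<open>The number of summands does not depend on the word, so even sums of natural numbers take
  finitely many values.\<close>

lemma definable_finite_sum:
  fixes \<Phi> :: "nat \<Rightarrow> nat list \<Rightarrow> (nat \<Rightarrow> nat) \<Rightarrow> 'b::comm_monoid_add"
  assumes "\<And>u. u < k \<Longrightarrow> definable Z n (\<Phi> u)"
  shows "definable Z n (\<lambda>w e. \<Sum>u<k. \<Phi> u w e)"
  using assms
proof (induction k)
  case (Suc k)
  then show ?case using definable_map2[of Z n "\<lambda>w e. \<Sum>u<k. \<Phi> u w e" "\<Phi> k" "(+)"] by simp
qed (simp add: definable_const)

lemma definable_finite_all:
  fixes k :: nat
  assumes "\<And>u. u < k \<Longrightarrow> definable Z n (\<Phi> u)"
  shows "definable Z n (\<lambda>w e. \<forall>u<k. \<Phi> u w e)"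
  using assms
proof (induction k)
  case (Suc k)
  then show ?case
    using definable_map2[of Z n "\<lambda>w e. \<forall>u<k. \<Phi> u w e" "\<Phi> k" "(\<and>)"] by (simp add: less_Suc_eq all_conj_distrib conj_commute imp_disjL)
qed (simp add: definable_const)

text \<open>Moving both pointers to the left, the smaller one reaches the blank in front first.\<close>

lemma definable_less: "definable Z n (\<lambda>w e. e i < e j)"
proof (rule definableI[where dec = "\<lambda>v. v = 1"])
  let ?C = "\<lambda>(_::bool) x y. x \<noteq> (0::nat) \<and> y \<noteq> (0::nat)" and ?r = "\<lambda>x y::nat. if y \<noteq> 0 then 1 else 0 :: nat"
  show "wf_query 2 (Suc (max i j)) n (Scan Go_Left ?C ?r i j)" by auto
  fix w e assume v: "valid Z w e"
  show "(e i < e j) = (query_value Z w e (Scan Go_Left ?C ?r i j) = 1)"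
  proof -
    define m where "m = scan_len Z w Go_Left ?C (e i) (e j)"
    have nz: "pad_sym Z w p = 0 \<longleftrightarrow> p = 0" if "p < length w + 2" for p
      using that v pad_sym_eq_0_iff[of w Z p] by (auto simp: valid_def)
    have p: "e i < length w + 2" "e j < length w + 2" using v by (auto simp: valid_def)
    \<comment> \<open>By this and the next fact \<open>m\<close> is the smaller of the two
      positions, so \<open>e j - m\<close> is positive iff \<open>e i < e j\<close>.\<close>
    have stop: "e i \<le> m \<or> e j \<le> m"
      using scan_len_stop[of ?C Go_Left "e i" w m Z "e j"] p nz by (auto simp: m_def)
    have cont: "l < e i \<and> l < e j" if "l < m" for l
      using scan_len_continue[of l Z w Go_Left ?C "e i" "e j"] that p nz by (auto simp: m_def)
    have "query_value Z w e (Scan Go_Left ?C ?r i j) = 1 \<longleftrightarrow> m < e j"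
    proof -
      have "query_value Z w e (Scan Go_Left ?C ?r i j) = ?r (pad_sym Z w (e i - m)) (pad_sym Z w (e j - m))"
        by (simp only: query_value.simps m_def Let_def shift.simps)
      then show ?thesis using p nz[of "e j - m"] by auto
    qed
    moreover have "e i < e j \<longleftrightarrow> m < e j"
      using stop cont[of "e i"] cont[of "e j"] by force
    ultimately show ?thesis by simp
  qed
qed

section \<open>Comparing the names of variables\<close>

definition digit :: "nat \<Rightarrow> bool" where
  "digit x \<longleftrightarrow> x = 1 \<or> x = 2"

definition name_at :: "nat list \<Rightarrow> nat \<Rightarrow> nat list" where
  "name_at u p = takeWhile digit (drop (Suc p) u)"

text \<open>Before \<open>k\<close> both prefixes agree. If one of the letters at \<open>k\<close>
  satisfies \<open>P\<close>, the other prefix has ended or continues differently. Reading 0 behind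
  the end, where \<open>P\<close> fails, treats the end of a list like a terminating letter.\<close>

lemma takeWhile_eq_iff_first_difference:
  fixes xs ys :: "nat list"
  defines "get \<equiv> \<lambda>zs m. if m < length zs then zs ! m else 0"
  assumes "\<And>m. m < k \<Longrightarrow> get xs m = get ys m \<and> P (get xs m)" and "\<not> (get xs k = get ys k \<and> P (get xs k))"
    and "\<not> P 0"
  shows "takeWhile P xs = takeWhile P ys \<longleftrightarrow> \<not> P (get xs k) \<and> \<not> P (get ys k)"
  using assms(2,3)
proof (induction k arbitrary: xs ys)
  case 0
  then show ?case using assms(4) by (cases xs; cases ys) (auto simp: get_def)
next
  case (Suc k)
  have "get xs 0 = get ys 0 \<and> P (get xs 0)" by (rule Suc.prems(1)) simp
  then obtain x xs' ys' where xs: "xs = x # xs'" "ys = x # ys'" "P x"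
    using assms(4) by (cases xs; cases ys) (auto simp: get_def)
  have "takeWhile P xs' = takeWhile P ys' \<longleftrightarrow> \<not> P (get xs' k) \<and> \<not> P (get ys' k)"
  proof (rule Suc.IH)
    have get: "get (z # zs) (Suc m) = get zs m" for z zs m by (simp add: get_def)
    show "get xs' m = get ys' m \<and> P (get xs' m)" if "m < k" for m
      using Suc.prems(1)[OF Suc_mono[OF that]] unfolding xs get .
    show "\<not> (get xs' k = get ys' k \<and> P (get xs' k))"
      using Suc.prems(2) by (simp add: xs get)
  qed
  then show ?case using xs by (simp add: get_def)
qed

lemma definable_same_name:
  "definable Z n (\<lambda>w e. pad_sym Z w (e i) = 3 \<and> pad_sym Z w (e j) = 3 \<and>
     name_at (padded Z w) (e i) = name_at (padded Z w) (e j))"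
proof -
  \<comment> \<open>The flag lets the scan leave the letters 3; then it runs over common digits, and
    the names agree iff neither pointer stops on a digit. If a pointer does not start on a 3, the
    answer of the scan says nothing; hence the extra tests in \<open>\<Theta>\<close>.\<close>
  let ?C = "\<lambda>b x y. if b then x = 3 \<and> y = 3 else x = y \<and> digit x"
  let ?r = "\<lambda>x y. if digit x \<or> digit y then 0 else 1 :: nat"
  let ?q = "Scan Go_Right ?C ?r i j"
  let ?\<Psi> = "\<lambda>w e. query_value Z w e ?q = 1"
  have \<Psi>: "definable Z n ?\<Psi>"
    by (rule definableI[where V = 2 and H = "Suc (max i j)" and dec = "\<lambda>v. v = 1", OF _ refl])
      (auto simp: digit_def split: if_splits)
  define \<Theta> where "\<Theta> w e \<longleftrightarrow> pad_sym Z w (e i) = 3 \<and> pad_sym Z w (e j) = 3 \<and> ?\<Psi> w e" for w e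
  have \<Theta>: "definable Z n \<Theta>"
    unfolding \<Theta>_def
    by (intro definable_map2[where F = "(\<and>)"] definable_map[where F = "\<lambda>x. x = 3"] definable_sym \<Psi>)
  have "\<Theta> w e = (pad_sym Z w (e i) = 3 \<and> pad_sym Z w (e j) = 3 \<and>
     name_at (padded Z w) (e i) = name_at (padded Z w) (e j))" if v: "valid Z w e" for w e
  proof (cases "pad_sym Z w (e i) = 3 \<and> pad_sym Z w (e j) = 3")
    case True
    define m where "m = scan_len Z w Go_Right ?C (e i) (e j)"
    have stop: "\<not> ?C (m = 0) (pad_sym Z w (e i + m)) (pad_sym Z w (e j + m))"
    proof -
      have "\<not> ?C (m = 0) (pad_sym Z w (shift Go_Right m (e i))) (pad_sym Z w (shift Go_Right m (e j)))"
        by (rule scan_len_stop[OF _ _ _ m_def]) (use v in \<open>auto simp: valid_def digit_def split: if_splits\<close>)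
      then show ?thesis unfolding shift.simps .
    qed
    have cont: "?C (l = 0) (pad_sym Z w (e i + l)) (pad_sym Z w (e j + l))" if "l < m" for l
      using scan_len_continue[OF that[unfolded m_def]] unfolding shift.simps .
    obtain k where m: "m = Suc k" using stop True by (cases m) auto
    have get: "pad_sym Z w (Suc (p + l)) =
        (if l < length (drop (Suc p) (padded Z w)) then drop (Suc p) (padded Z w) ! l else 0)" for p l
      by (auto simp: pad_sym_def padded_def nth_append)
    have "name_at (padded Z w) (e i) = name_at (padded Z w) (e j) \<longleftrightarrow>
        \<not> digit (pad_sym Z w (Suc (e i + k))) \<and> \<not> digit (pad_sym Z w (Suc (e j + k)))"
      unfolding name_at_def get
    proof (rule takeWhile_eq_iff_first_difference, unfold get[symmetric])
      fix l assume "l < k"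
      then show "pad_sym Z w (Suc (e i + l)) = pad_sym Z w (Suc (e j + l)) \<and> digit (pad_sym Z w (Suc (e i + l)))"
        using cont[of "Suc l"] m by (metis Suc_mono add_Suc_right nat.distinct(2))
    next
      show "\<not> (pad_sym Z w (Suc (e i + k)) = pad_sym Z w (Suc (e j + k)) \<and> digit (pad_sym Z w (Suc (e i + k))))"
        using stop m by simp
    qed (simp add: digit_def)
    moreover have "?\<Psi> w e \<longleftrightarrow> \<not> digit (pad_sym Z w (Suc (e i + k))) \<and> \<not> digit (pad_sym Z w (Suc (e j + k)))"
      using m by (simp add: m_def[symmetric] Let_def)
    ultimately show ?thesis by (simp add: \<Theta>_def)
  qed (auto simp: \<Theta>_def)
  then show ?thesis by (rule definable_cong[OF \<Theta>])
qed

section \<open>Loops over tuples of positions\<close>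

fun extend :: "(nat \<Rightarrow> nat) \<Rightarrow> nat \<Rightarrow> nat list \<Rightarrow> nat \<Rightarrow> nat" where
  "extend e n [] = e"
| "extend e n (k # ks) = extend (e(n := k)) (Suc n) ks"

lemma extend_outside: "i < n \<or> n + length ks \<le> i \<Longrightarrow> extend e n ks i = e i"
  by (induction e n ks rule: extend.induct) auto

lemma extend_inside: "u < length ks \<Longrightarrow> extend e n ks (n + u) = ks ! u"
proof (induction e n ks arbitrary: u rule: extend.induct)
  case (2 e n k ks)
  show ?case
  proof (cases u)
    case (Suc v)
    then show ?thesis using "2.IH"[of v] "2.prems" by (simp del: fun_upd_apply)
  qed (simp add: extend_outside)
qed simp

definition tuples :: "nat \<Rightarrow> nat \<Rightarrow> nat list set" where
  "tuples K N = {ks. length ks = K \<and> set ks \<subseteq> {..<N}}"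

lemma finite_tuples [simp]: "finite (tuples K N)"
  unfolding tuples_def using finite_lists_length_eq[of "{..<N}" K] by (simp add: conj_commute)

lemma tuples_0: "tuples 0 N = {[]}"
  by (auto simp: tuples_def)

lemma tuples_Suc: "tuples (Suc K) N = (\<lambda>(k, ks). k # ks) ` ({..<N} \<times> tuples K N)"
  by (auto simp: tuples_def length_Suc_conv image_iff)

lemma sum_tuples_Suc: "(\<Sum>ks\<in>tuples (Suc K) N. f ks) = (\<Sum>k<N. \<Sum>ks\<in>tuples K N. f (k # ks))"
proof -
  have "inj_on (\<lambda>(k, ks). k # ks) ({..<N} \<times> tuples K N)" by (auto simp: inj_on_def)
  then show ?thesis by (simp add: tuples_Suc sum.reindex sum.cartesian_product split_def)
qed

lemma ex_tuples_Suc: "(\<exists>ks\<in>tuples (Suc K) N. P ks) \<longleftrightarrow> (\<exists>k<N. \<exists>ks\<in>tuples K N. P (k # ks))"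
  by (auto simp: tuples_Suc)

lemma definable_sum_tuples:
  fixes \<Phi> :: "nat list \<Rightarrow> (nat \<Rightarrow> nat) \<Rightarrow> 'b::{comm_monoid_add,finite}"
  assumes "definable Z (n + K) \<Phi>"
  shows "definable Z n (\<lambda>w e. \<Sum>ks\<in>tuples K (length w + 2). \<Phi> w (extend e n ks))"
  using assms
proof (induction K arbitrary: n)
  case (Suc K)
  then have "definable Z (Suc n) (\<lambda>w e. \<Sum>ks\<in>tuples K (length w + 2). \<Phi> w (extend e (Suc n) ks))" by simp
  from definable_sum[OF this] show ?case by (simp only: sum_tuples_Suc extend.simps)
qed (simp add: tuples_0)

lemma definable_ex_tuples:
  assumes "definable Z (n + K) \<Phi>"
  shows "definable Z n (\<lambda>w e. \<exists>ks\<in>tuples K (length w + 2). \<Phi> w (extend e n ks))"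
  using assms
proof (induction K arbitrary: n)
  case (Suc K)
  then have "definable Z (Suc n) (\<lambda>w e. \<exists>ks\<in>tuples K (length w + 2). \<Phi> w (extend e (Suc n) ks))" by simp
  from definable_ex[OF this] show ?case by (simp only: ex_tuples_Suc extend.simps)
qed (simp add: tuples_0)

theorem definable_decidable:
  assumes "definable Z 0 (\<lambda>w e. P w)" and "0 < Z"
  obtains M p where "wf_tm M" and "\<And>w. set w \<subseteq> {1..<Z} \<Longrightarrow> answers_within M w (P w) (poly p (length w))"
proof -
  have "definable Z 0 (\<lambda>w e. if P w then 1 else 0 :: nat)"
    using definable_map[OF assms(1), of "\<lambda>b. if b then 1 else 0 :: nat"] .
  then obtain V H q dec where q: "wf_query V H 0 q"
    "\<And>w e. valid Z w e \<Longrightarrow> (if P w then 1 else 0 :: nat) = dec (query_value Z w e q)"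
    unfolding definable_def by blast
  \<comment> \<open>Moving the decoding into the query makes the value 0 mean rejection;
    \<open>q\<close> is taken twice because \<open>App\<close> is binary.\<close>
  have "wf_query (max V 2) H 0 (App (\<lambda>x y. if dec x = 1 then 1 else 0) q q)"
    using wf_query_mono[OF q(1), of "max V 2" H 0] by auto
  from query_decidable[OF this assms(2)] obtain M p where M: "wf_tm M" and
    run: "\<And>w. set w \<subseteq> {1..<Z} \<Longrightarrow>
       answers_within M w (query_value Z w (\<lambda>_. 0) (App (\<lambda>x y. if dec x = 1 then 1 else 0) q q) \<noteq> 0) (poly p (length w))"
    by blast
  have iff: "query_value Z w (\<lambda>_. 0) (App (\<lambda>x y. if dec x = 1 then 1 else 0) q q) \<noteq> 0 \<longleftrightarrow> P w"
    if "set w \<subseteq> {1..<Z}" for w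
    using q(2)[of w "\<lambda>_. 0"] that assms(2) by (auto simp: valid_def split: if_splits)
  show ?thesis by (rule that[OF M]) (use run iff in \<open>simp only:\<close>)
qed

section \<open>Independence of multiplicative functions\<close>

text \<open>Dedekind's independence of characters by Artin's argument: subtracting
  \<open>k y\<close> times the relation at \<open>x\<close> from the relation at
  \<open>mul x y\<close> cancels \<open>k\<close> and leaves a shorter relation with coefficients
  \<open>a h * (h y - k y)\<close>. It works without inverses, which matrices with a zero on the
  support lack for entrywise multiplication.\<close>

lemma multiplicative_independent:
  fixes H :: "('x \<Rightarrow> 'b::idom) set"
  assumes "finite H" and closed: "\<And>x y. x \<in> X \<Longrightarrow> y \<in> X \<Longrightarrow> mul x y \<in> X"
    and mult: "\<And>h x y. h \<in> H \<Longrightarrow> x \<in> X \<Longrightarrow> y \<in> X \<Longrightarrow> h (mul x y) = h x * h y"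
    and nonzero: "\<And>h. h \<in> H \<Longrightarrow> \<exists>x\<in>X. h x \<noteq> 0"
    and distinct: "\<And>h h'. h \<in> H \<Longrightarrow> h' \<in> H \<Longrightarrow> \<forall>x\<in>X. h x = h' x \<Longrightarrow> h = h'"
    and zero: "\<And>x. x \<in> X \<Longrightarrow> (\<Sum>h\<in>H. a h * h x) = 0"
    and "h \<in> H"
  shows "a h = 0"
  using assms
proof (induction H arbitrary: a h rule: finite_induct)
  case (insert k H)
  have H: "a h * (h y - k y) = 0" if "h \<in> H" "y \<in> X" for h y
  proof (rule insert.IH[where a = "\<lambda>h. a h * (h y - k y)"])
    fix x assume x: "x \<in> X"
    have "(\<Sum>h\<in>insert k H. a h * h (mul x y)) - k y * (\<Sum>h\<in>insert k H. a h * h x) = 0"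
      using insert.prems(5)[of "mul x y"] insert.prems(5)[of x] insert.prems(1)[of x y] x that by simp
    then have "(\<Sum>h\<in>insert k H. a h * h x * h y - k y * (a h * h x)) = 0"
      using insert.prems(2) x that by (simp add: sum_subtractf sum_distrib_left mult.assoc)
    then show "(\<Sum>h\<in>H. a h * (h y - k y) * h x) = 0"
      using insert.hyps by (simp add: algebra_simps)
  qed (use insert.prems that in auto)
  have a: "a h = 0" if h: "h \<in> H" for h
  proof -
    have "h \<noteq> k" using h insert.hyps by auto
    then obtain y where "y \<in> X" "h y \<noteq> k y" using insert.prems(4)[of h k] h by auto
    then show ?thesis using H[OF h, of y] by simp
  qed
  obtain x where x: "x \<in> X" "k x \<noteq> 0" using insert.prems(3)[of k] by auto
  have "a k * k x = 0" using insert.prems(5)[OF x(1)] insert.hyps a by simp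
  then show ?case using x(2) a insert.prems(6) by auto
qed simp

section \<open>Triangular weighted automata\<close>

text \<open>
  The weight of a step may depend on the value of a variable only if
  the letter read is 3; the name of that variable consists of the digits that follow.
\<close>

definition step_weight ::
  "(nat \<Rightarrow> nat \<Rightarrow> nat \<Rightarrow> 'a) \<Rightarrow> (nat \<Rightarrow> nat \<Rightarrow> 'g \<Rightarrow> 'a) \<Rightarrow> nat \<Rightarrow> 'g \<Rightarrow> nat \<Rightarrow> nat \<Rightarrow> 'a::comm_ring_1" where
  "step_weight c x a g s s' = c a s s' * (if a = 3 then x s s' g else 1)"

fun run ::
  "nat \<Rightarrow> (nat \<Rightarrow> nat \<Rightarrow> nat \<Rightarrow> 'a) \<Rightarrow> (nat \<Rightarrow> nat \<Rightarrow> 'g \<Rightarrow> 'a) \<Rightarrow> (nat \<Rightarrow> 'a) \<Rightarrow>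
     (nat list \<Rightarrow> 'g) \<Rightarrow> nat list \<Rightarrow> nat \<Rightarrow> 'a::comm_ring_1" where
  "run R c x b \<sigma> [] s = b s"
| "run R c x b \<sigma> (a # w) s =
     (\<Sum>s'<R. step_weight c x a (\<sigma> (takeWhile digit w)) s s' * run R c x b \<sigma> w s')"

text \<open>States never descend. A step weight is split into a constant from \<open>c\<close> and a
  function from \<open>B\<close>, so that the weight of a path becomes a coefficient times a product
  of functions from \<open>B\<close> evaluated at variables.\<close>

definition recognizable ::
  "('g \<Rightarrow> 'a::comm_ring_1) set \<Rightarrow> ((nat list \<Rightarrow> 'g) \<Rightarrow> nat list \<Rightarrow> 'a) \<Rightarrow> bool" where
  "recognizable B \<Phi> \<longleftrightarrow>
     (\<exists>R c x i b. 0 < R \<and> (\<forall>s s'. x s s' \<in> B) \<and> (\<forall>a s s'. s' < s \<longrightarrow> c a s s' = 0) \<and>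
        (\<forall>\<sigma> w. \<Phi> \<sigma> w = (\<Sum>s<R. i s * run R c x b \<sigma> w s)))"

lemma sum_lessThan_add: "(\<Sum>s<m + n. f s) = (\<Sum>s<m. f s) + (\<Sum>s<n. f (m + s))"
  for f :: "nat \<Rightarrow> 'b::comm_monoid_add"
  by (induction n) (auto simp: ac_simps)

lemma sum_lessThan_mult: "(\<Sum>s<m * n. f s) = (\<Sum>i<m. \<Sum>j<n. f (i * n + j))"
  for f :: "nat \<Rightarrow> 'b::comm_monoid_add"
proof (induction m)
  case (Suc m)
  have "Suc m * n = m * n + n" by simp
  then show ?case using Suc by (simp only: sum_lessThan_add) simp
qed simp

lemma recognizableI:
  assumes "0 < R" and "\<And>s s'. x s s' \<in> B" and "\<And>a s s'. s' < s \<Longrightarrow> c a s s' = 0"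
    and "\<And>\<sigma> w. \<Phi> \<sigma> w = (\<Sum>s<R. i s * run R c x b \<sigma> w s)"
  shows "recognizable B \<Phi>"
  using assms unfolding recognizable_def by blast

lemma recognizableE:
  assumes "recognizable B \<Phi>"
  obtains R c x i b where "0 < R" and "\<And>s s'. x s s' \<in> B" and "\<And>a s s'. s' < s \<Longrightarrow> c a s s' = 0"
    and "\<And>\<sigma> w. \<Phi> \<sigma> w = (\<Sum>s<R. i s * run R c x b \<sigma> w s)"
proof -
  obtain R c x i b where h: "0 < R" "\<forall>s s'. x s s' \<in> B" "\<forall>a s s'. s' < s \<longrightarrow> c a s s' = 0"
    "\<forall>\<sigma> w. \<Phi> \<sigma> w = (\<Sum>s<R. i s * run R c x b \<sigma> w s)"
    using assms unfolding recognizable_def by (elim exE conjE)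
  show thesis by (rule that[of R x c i b]; rule h[rule_format]; assumption?)
qed

lemma recognizable_const:
  assumes "(\<lambda>_. 1) \<in> B"
  shows "recognizable B (\<lambda>\<sigma> w. k)"
proof (rule recognizableI[where R = 1 and c = "\<lambda>a s s'. of_bool (s = s')" and x = "\<lambda>s s' g. 1"
      and i = "\<lambda>_. k" and b = "\<lambda>_. 1"])
  fix \<sigma> :: "nat list \<Rightarrow> 'a" and w
  have "run 1 (\<lambda>a s s'. of_bool (s = s')) (\<lambda>s s' g. 1) (\<lambda>_. 1) \<sigma> w 0 = (1::'b)"
    by (induction w) (auto simp: step_weight_def)
  then show "k = (\<Sum>s<1. k * run 1 (\<lambda>a s s'. of_bool (s = s')) (\<lambda>s s' g. 1) (\<lambda>_. 1) \<sigma> w s)" by simp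
qed (use assms in auto)

lemma recognizable_add:
  assumes "recognizable B \<Phi>" and "recognizable B \<Psi>"
  shows "recognizable B (\<lambda>\<sigma> w. \<Phi> \<sigma> w + \<Psi> \<sigma> w)"
proof -
  obtain R c x i b where 1: "0 < R" "\<And>s s'. x s s' \<in> B" "\<And>a s s'. s' < s \<Longrightarrow> c a s s' = 0"
    "\<And>\<sigma> w. \<Phi> \<sigma> w = (\<Sum>s<R. i s * run R c x b \<sigma> w s)"
    by (rule recognizableE[OF assms(1)]) (rule that)
  obtain R' c' x' i' b' where 2: "0 < R'" "\<And>s s'. x' s s' \<in> B" "\<And>a s s'. s' < s \<Longrightarrow> c' a s s' = 0"
    "\<And>\<sigma> w. \<Psi> \<sigma> w = (\<Sum>s<R'. i' s * run R' c' x' b' \<sigma> w s)"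
    by (rule recognizableE[OF assms(2)]) (rule that)
  define C where "C a s s' = (if s < R \<and> s' < R then c a s s'
    else if R \<le> s \<and> R \<le> s' then c' a (s - R) (s' - R) else 0)" for a s s'
  define Y where "Y s s' = (if s < R then x s s' else x' (s - R) (s' - R))" for s s'
  define I where "I s = (if s < R then i s else i' (s - R))" for s
  define E where "E s = (if s < R then b s else b' (s - R))" for s
  have left: "run (R + R') C Y E \<sigma> w s = run R c x b \<sigma> w s" if "s < R" for \<sigma> w s
    using that by (induction w arbitrary: s) (auto simp: sum_lessThan_add step_weight_def C_def Y_def E_def intro!: sum.cong)
  have right: "run (R + R') C Y E \<sigma> w (R + s) = run R' c' x' b' \<sigma> w s" if "s < R'" for \<sigma> w s
    using that by (induction w arbitrary: s) (auto simp: sum_lessThan_add step_weight_def C_def Y_def E_def intro!: sum.cong)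
  show ?thesis
  proof (rule recognizableI[where R = "R + R'" and c = C and x = Y and i = I and b = E])
    show "\<Phi> \<sigma> w + \<Psi> \<sigma> w = (\<Sum>s<R + R'. I s * run (R + R') C Y E \<sigma> w s)" for \<sigma> w
      by (simp add: sum_lessThan_add left right I_def 1(4) 2(4))
  qed (use 1 2 in \<open>auto simp: C_def Y_def\<close>)
qed

text \<open>Product automaton, with the pair \<open>(s, s')\<close> numbered
  \<open>s * R' + s'\<close>. Both components read a variable at once, so their functions are
  multiplied pointwise; \<open>B\<close> has to be closed under this.\<close>

lemma recognizable_mult:
  assumes "recognizable B \<Phi>" and "recognizable B \<Psi>"
    and B: "\<And>h h'. h \<in> B \<Longrightarrow> h' \<in> B \<Longrightarrow> (\<lambda>g. h g * h' g) \<in> B"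
  shows "recognizable B (\<lambda>\<sigma> w. \<Phi> \<sigma> w * \<Psi> \<sigma> w)"
proof -
  obtain R c x i b where 1: "0 < R" "\<And>s s'. x s s' \<in> B" "\<And>a s s'. s' < s \<Longrightarrow> c a s s' = 0"
    "\<And>\<sigma> w. \<Phi> \<sigma> w = (\<Sum>s<R. i s * run R c x b \<sigma> w s)"
    by (rule recognizableE[OF assms(1)]) (rule that)
  obtain R' c' x' i' b' where 2: "0 < R'" "\<And>s s'. x' s s' \<in> B" "\<And>a s s'. s' < s \<Longrightarrow> c' a s s' = 0"
    "\<And>\<sigma> w. \<Psi> \<sigma> w = (\<Sum>s<R'. i' s * run R' c' x' b' \<sigma> w s)"
    by (rule recognizableE[OF assms(2)]) (rule that)
  define C where "C a s s' = c a (s div R') (s' div R') * c' a (s mod R') (s' mod R')" for a s s'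
  define Y where "Y s s' g = x (s div R') (s' div R') g * x' (s mod R') (s' mod R') g" for s s' g
  define I where "I s = i (s div R') * i' (s mod R')" for s
  define E where "E s = b (s div R') * b' (s mod R')" for s
  have run: "run (R * R') C Y E \<sigma> w (s * R' + s') = run R c x b \<sigma> w s * run R' c' x' b' \<sigma> w s'"
    if "s' < R'" for \<sigma> w s s'
    using that
  proof (induction w arbitrary: s s')
    case (Cons a w)
    let ?v = "step_weight c x a (\<sigma> (takeWhile digit w)) s" and ?v' = "step_weight c' x' a (\<sigma> (takeWhile digit w)) s'"
    have "run (R * R') C Y E \<sigma> (a # w) (s * R' + s') =
        (\<Sum>i<R. \<Sum>j<R'. (?v i * ?v' j) * run (R * R') C Y E \<sigma> w (i * R' + j))"
      unfolding run.simps sum_lessThan_mult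
      using Cons.prems by (intro sum.cong refl) (simp add: step_weight_def C_def Y_def)
    also have "\<dots> = (\<Sum>i<R. \<Sum>j<R'. (?v i * run R c x b \<sigma> w i) * (?v' j * run R' c' x' b' \<sigma> w j))"
      using Cons.IH by (intro sum.cong refl) simp
    also have "\<dots> = run R c x b \<sigma> (a # w) s * run R' c' x' b' \<sigma> (a # w) s'"
      by (simp add: sum_product)
    finally show ?case .
  qed (simp add: E_def)
  show ?thesis
  proof (rule recognizableI[where R = "R * R'" and c = C and x = Y and i = I and b = E])
    show "\<Phi> \<sigma> w * \<Psi> \<sigma> w = (\<Sum>s<R * R'. I s * run (R * R') C Y E \<sigma> w s)" for \<sigma> w
    proof -
      have "(\<Sum>s<R * R'. I s * run (R * R') C Y E \<sigma> w s) =
          (\<Sum>s<R. \<Sum>s'<R'. (i s * run R c x b \<sigma> w s) * (i' s' * run R' c' x' b' \<sigma> w s'))"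
        unfolding sum_lessThan_mult by (intro sum.cong refl) (simp add: run I_def)
      then show ?thesis by (simp add: 1(4) 2(4) sum_product)
    qed
    \<comment> \<open>The numbering orders pairs lexicographically: when it descends, the first
      component descends, or it stays and the second descends. Either way a factor of
      \<open>C\<close> is 0.\<close>
    show "C a s s' = 0" if "s' < s" for a s s'
    proof (cases "s' div R' < s div R'")
      case False
      then have "s' div R' = s div R'" using that by (meson div_le_mono less_imp_le le_antisym not_le)
      then have "s' mod R' < s mod R'"
        using that mult_div_mod_eq[of R' s] mult_div_mod_eq[of R' s'] by (metis add_less_cancel_left)
      then show ?thesis by (simp add: C_def 2(3))
    qed (simp add: C_def 1(3))
    show "Y s s' \<in> B" for s s' unfolding Y_def by (intro B 1 2)
  qed (use 1(1) 2(1) in simp)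
qed

lemma recognizable_prod:
  assumes "\<And>j. j \<in> J \<Longrightarrow> recognizable B (\<Phi> j)" and "(\<lambda>_. 1) \<in> B"
    and "\<And>h h'. h \<in> B \<Longrightarrow> h' \<in> B \<Longrightarrow> (\<lambda>g. h g * h' g) \<in> B"
  shows "recognizable B (\<lambda>\<sigma> w. \<Prod>j\<in>J. \<Phi> j \<sigma> w)"
proof (cases "finite J")
  case True
  then show ?thesis using assms(1)
    by (induction J) (auto intro: recognizable_const recognizable_mult assms(2,3))
qed (simp add: recognizable_const assms(2))

text \<open>The letters 0 and \<open>Z\<close> of the padded word take over the initial and the final weights.\<close>

lemma recognizable_padded:
  assumes "recognizable B \<Phi>" and Z: "3 < Z"
  obtains K c x where "\<And>s s'. x s s' \<in> B" and "\<And>a s s'. s' < s \<Longrightarrow> c a s s' = 0"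
    and "\<And>\<sigma> w. set w \<subseteq> {1..<Z} \<Longrightarrow>
      \<Phi> \<sigma> w = run (Suc K) c x (\<lambda>s. of_bool (s = K)) \<sigma> (padded Z w) 0"
proof -
  obtain R c x i b where 1: "0 < R" "\<And>s s'. x s s' \<in> B" "\<And>a s s'. s' < s \<Longrightarrow> c a s s' = 0"
    "\<And>\<sigma> w. \<Phi> \<sigma> w = (\<Sum>s<R. i s * run R c x b \<sigma> w s)"
    by (rule recognizableE[OF assms(1)]) (rule that)
  obtain K where R: "R = Suc K" using 1(1) by (cases R) auto
  \<comment> \<open>The letter 0 leads from state 0 to every state with its initial weight, and
    \<open>Z\<close> leads from every state to the topmost one with its final weight. Neither step
    descends, so triangularity is preserved.\<close>
  define C where "C a s s' = (if a = 0 then if s = 0 then i s' else 0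
    else if a = Z then if s \<le> K \<and> s' = K then b s else 0 else c a s s')" for a s s'
  have digit_Z: "\<not> digit Z" using Z by (simp add: digit_def)
  have end_run: "run (Suc K) C x (\<lambda>s. of_bool (s = K)) \<sigma> (w @ [Z]) s = run R c x b \<sigma> w s"
    if "set w \<subseteq> {1..<Z}" "s < R" for \<sigma> w s
    using that
  proof (induction w arbitrary: s)
    case Nil
    then show ?case using Z by (simp add: R step_weight_def C_def)
  next
    case (Cons a w)
    have "takeWhile digit (w @ [Z]) = takeWhile digit w" using digit_Z by (induction w) auto
    then show ?case using Cons Z by (auto simp: R step_weight_def C_def intro!: sum.cong)
  qed
  show ?thesis
  proof (rule that)
    show "\<Phi> \<sigma> w = run (Suc K) C x (\<lambda>s. of_bool (s = K)) \<sigma> (padded Z w) 0" if "set w \<subseteq> {1..<Z}" for \<sigma> w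
    proof -
      have "run (Suc K) C x (\<lambda>s. of_bool (s = K)) \<sigma> (padded Z w) 0 =
          (\<Sum>s<R. i s * run (Suc K) C x (\<lambda>s. of_bool (s = K)) \<sigma> (w @ [Z]) s)"
        by (simp only: padded_def run.simps R) (simp add: step_weight_def C_def)
      then show ?thesis using end_run[OF that] by (simp add: 1(4))
    qed
  qed (use 1 in \<open>auto simp: C_def\<close>)
qed

section \<open>Paths as sorted tuples of positions\<close>

text \<open>
  A path from state 0 to state \<open>K\<close> that never descends is encoded by the positions at which it
  passes the states 0 to \<open>K - 1\<close>: before reading position \<open>p\<close> it is in the
  state \<open>below ks p\<close>.
\<close>

definition below :: "nat list \<Rightarrow> nat \<Rightarrow> nat" where
  "below ks p = length (filter (\<lambda>k. k < p) ks)"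

definition sorted_tuples :: "nat \<Rightarrow> nat \<Rightarrow> nat list set" where
  "sorted_tuples m N = {ks \<in> tuples m N. sorted ks}"

lemma finite_sorted_tuples [simp]: "finite (sorted_tuples m N)"
  by (simp add: sorted_tuples_def)

lemma sorted_tuples_Suc:
  "sorted_tuples (Suc m) (Suc N) = (#) 0 ` sorted_tuples m (Suc N) \<union> map Suc ` sorted_tuples (Suc m) N"
proof (intro equalityI subsetI)
  fix ks assume ks: "ks \<in> sorted_tuples (Suc m) (Suc N)"
  show "ks \<in> (#) 0 ` sorted_tuples m (Suc N) \<union> map Suc ` sorted_tuples (Suc m) N"
  proof (cases "hd ks = 0")
    case True
    then show ?thesis using ks by (cases ks) (auto simp: sorted_tuples_def tuples_def)
  next
    case False
    then have pos: "0 < k" if "k \<in> set ks" for k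
      using ks that by (cases ks) (auto simp: sorted_tuples_def tuples_def)
    have "ks = map Suc (map (\<lambda>k. k - 1) ks)" using pos by (induction ks) auto
    moreover have "map (\<lambda>k. k - 1) ks \<in> sorted_tuples (Suc m) N"
    proof -
      have "sorted (map (\<lambda>k. k - 1) ks)" if "sorted ks" for ks :: "nat list"
        using that by (induction ks) auto
      moreover have "k - 1 < N" if "k \<in> set ks" for k
        using ks pos[OF that] that by (auto simp: sorted_tuples_def tuples_def)
      ultimately show ?thesis using ks by (auto simp: sorted_tuples_def tuples_def)
    qed
    ultimately show ?thesis by blast
  qed
qed (auto simp: sorted_tuples_def tuples_def sorted_map)

text \<open>\<open>j\<close> is the number of entries 0, that is, how far the path rises on the
  first letter; the other entries, lowered by one, describe the path on the rest of the
  word.\<close>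

lemma sum_sorted_tuples_Suc:
  fixes f :: "nat list \<Rightarrow> 'b::comm_monoid_add"
  shows "(\<Sum>ks\<in>sorted_tuples m (Suc N). f ks) =
    (\<Sum>j\<le>m. \<Sum>ks\<in>sorted_tuples (m - j) N. f (replicate j 0 @ map Suc ks))"
proof (induction m arbitrary: f)
  case 0
  then show ?case by (simp add: sorted_tuples_def tuples_0)
next
  case (Suc m)
  have "(\<Sum>ks\<in>sorted_tuples (Suc m) (Suc N). f ks) =
      (\<Sum>ks\<in>sorted_tuples m (Suc N). f (0 # ks)) + (\<Sum>ks\<in>sorted_tuples (Suc m) N. f (map Suc ks))"
    unfolding sorted_tuples_Suc
    by (subst sum.union_disjoint)
      (simp, simp, force simp: sorted_tuples_def, simp add: sum.reindex inj_on_def)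
  then show ?case by (simp add: Suc sum.atMost_Suc_shift add.commute del: sum.atMost_Suc)
qed

lemma below_shift: "below (replicate j 0 @ map Suc ks) (Suc p) = j + below ks p"
  by (simp add: below_def filter_map o_def)

lemma below_0 [simp]: "below ks 0 = 0"
  by (simp add: below_def)

lemma name_at_Cons [simp]: "name_at (a # u) 0 = takeWhile digit u" "name_at (a # u) (Suc p) = name_at u p"
  by (simp_all add: name_at_def)

text \<open>All \<open>K - s\<close> entries of a tuple are below \<open>length u\<close>, so its
  path rises by exactly \<open>K - s\<close> and ends in the one accepting state.\<close>

lemma run_eq_sum_paths:
  assumes tri: "\<And>a s s'. s' < s \<Longrightarrow> c a s s' = 0" and "s \<le> K"
  shows "run (Suc K) c x (\<lambda>s. of_bool (s = K)) \<sigma> u s =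
    (\<Sum>ks\<in>sorted_tuples (K - s) (length u).
       \<Prod>p<length u. step_weight c x (u ! p) (\<sigma> (name_at u p)) (s + below ks p) (s + below ks (Suc p)))"
  using assms(2)
proof (induction u arbitrary: s)
  case Nil
  have "sorted_tuples m 0 = (if m = 0 then {[]} else {})" for m
    by (auto simp: sorted_tuples_def tuples_def)
  then show ?case using Nil by auto
next
  case (Cons a u)
  let ?b = "\<lambda>s. of_bool (s = K)"
  let ?w = "\<lambda>s ks. \<Prod>p<length u. step_weight c x (u ! p) (\<sigma> (name_at u p)) (s + below ks p) (s + below ks (Suc p))"
  let ?v = "step_weight c x a (\<sigma> (takeWhile digit u)) s"
  \<comment> \<open>By triangularity only targets from \<open>s\<close> on contribute; the sum is
    split at \<open>s\<close>.\<close>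
  have K: "Suc K = s + Suc (K - s)" using Cons.prems by simp
  have "run (Suc K) c x ?b \<sigma> (a # u) s = (\<Sum>j<Suc (K - s). ?v (s + j) * run (Suc K) c x ?b \<sigma> u (s + j))"
    unfolding run.simps by (subst K, subst sum_lessThan_add) (simp add: step_weight_def tri)
  also have "\<dots> = (\<Sum>j\<le>K - s. \<Sum>ks\<in>sorted_tuples (K - s - j) (length u). ?v (s + j) * ?w (s + j) ks)"
    unfolding lessThan_Suc_atMost
    using Cons.prems by (intro sum.cong refl, subst Cons.IH) (auto simp: sum_distrib_left)
  also have "\<dots> = (\<Sum>ks\<in>sorted_tuples (K - s) (length (a # u)).
       \<Prod>p<length (a # u). step_weight c x ((a # u) ! p) (\<sigma> (name_at (a # u) p)) (s + below ks p) (s + below ks (Suc p)))"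
    by (simp add: sum_sorted_tuples_Suc prod.lessThan_Suc_shift below_shift add.assoc del: prod.lessThan_Suc)
  finally show ?case .
qed

text \<open>Coefficient 0 for unsorted tuples lets sums and loops range over all tuples, while each
  path is still counted once.\<close>

definition path_coeff :: "nat list \<Rightarrow> (nat \<Rightarrow> nat \<Rightarrow> nat \<Rightarrow> 'a) \<Rightarrow> nat list \<Rightarrow> 'a::comm_ring_1" where
  "path_coeff u c ks =
     (if sorted ks then \<Prod>p<length u. c (u ! p) (below ks p) (below ks (Suc p)) else 0)"

definition path_monomial ::
  "nat list \<Rightarrow> (nat \<Rightarrow> nat \<Rightarrow> 'g \<Rightarrow> 'a) \<Rightarrow> nat list \<Rightarrow> (nat list \<Rightarrow> 'g) \<Rightarrow> 'a::comm_ring_1" where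
  "path_monomial u x ks \<sigma> =
     (\<Prod>p<length u. if u ! p = 3 then x (below ks p) (below ks (Suc p)) (\<sigma> (name_at u p)) else 1)"

text \<open>The share of a single variable in the monomial, namely of the one announced at position
  \<open>t\<close>; it is constantly 1 if none is announced there.\<close>

definition variable_part ::
  "nat list \<Rightarrow> (nat \<Rightarrow> nat \<Rightarrow> 'g \<Rightarrow> 'a) \<Rightarrow> nat list \<Rightarrow> nat \<Rightarrow> 'g \<Rightarrow> 'a::comm_ring_1" where
  "variable_part u x ks t g =
     (\<Prod>p<length u. if u ! p = 3 \<and> u ! t = 3 \<and> name_at u p = name_at u t
        then x (below ks p) (below ks (Suc p)) g else 1)"

text \<open>\<open>ks\<close> represents a class of tuples with the same monomial; the inner sum is
  the coefficient of this monomial after collecting terms.\<close>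

definition path_test ::
  "nat list \<Rightarrow> nat \<Rightarrow> (nat \<Rightarrow> nat \<Rightarrow> nat \<Rightarrow> 'a) \<Rightarrow> (nat \<Rightarrow> nat \<Rightarrow> 'g \<Rightarrow> 'a::comm_ring_1) \<Rightarrow> bool" where
  "path_test u K c x \<longleftrightarrow> (\<exists>ks\<in>tuples K (length u).
     (\<Sum>ks'\<in>tuples K (length u).
        if \<forall>t<length u. variable_part u x ks t = variable_part u x ks' t
        then path_coeff u c ks' else 0) \<noteq> 0)"

lemma run_eq_sum_monomials:
  assumes "\<And>a s s'. s' < s \<Longrightarrow> c a s s' = 0"
  shows "run (Suc K) c x (\<lambda>s. of_bool (s = K)) \<sigma> u 0 =
    (\<Sum>ks\<in>tuples K (length u). path_coeff u c ks * path_monomial u x ks \<sigma>)"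
proof -
  have "run (Suc K) c x (\<lambda>s. of_bool (s = K)) \<sigma> u 0 =
      (\<Sum>ks\<in>sorted_tuples K (length u). path_coeff u c ks * path_monomial u x ks \<sigma>)"
    using run_eq_sum_paths[of c 0 K x \<sigma> u] assms
    by (auto simp: path_coeff_def path_monomial_def sorted_tuples_def step_weight_def prod.distrib intro!: sum.cong)
  also have "\<dots> = (\<Sum>ks\<in>tuples K (length u). path_coeff u c ks * path_monomial u x ks \<sigma>)"
    by (rule sum.mono_neutral_left) (auto simp: sorted_tuples_def path_coeff_def)
  finally show ?thesis .
qed

section \<open>Characters and the criterion for nonvanishing\<close>

locale mult_structure =
  fixes X :: "'g set" and mul :: "'g \<Rightarrow> 'g \<Rightarrow> 'g" and unit :: 'g
  assumes mul_closed: "\<And>g h. g \<in> X \<Longrightarrow> h \<in> X \<Longrightarrow> mul g h \<in> X" and unit_closed: "unit \<in> X"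
begin

text \<open>The value 1 outside \<open>X\<close> makes equality on \<open>X\<close> the same as
  equality of functions, and gives a finite \<open>X\<close> inside an infinite type only finitely
  many characters into a finite ring. The value at \<open>unit\<close> rules out the zero
  function.\<close>

definition characters :: "('g \<Rightarrow> 'a::comm_ring_1) set" where
  "characters = {h. (\<forall>g. g \<notin> X \<longrightarrow> h g = 1) \<and> (\<forall>g\<in>X. \<forall>g'\<in>X. h (mul g g') = h g * h g') \<and> h unit = 1}"

lemma one_in_characters: "(\<lambda>_. 1) \<in> characters"
  by (simp add: characters_def)

lemma mult_in_characters: "h \<in> characters \<Longrightarrow> h' \<in> characters \<Longrightarrow> (\<lambda>g. h g * h' g) \<in> characters"
  by (simp add: characters_def ac_simps)

lemma finite_characters: "finite X \<Longrightarrow> finite (characters :: ('g \<Rightarrow> 'a::{comm_ring_1,finite}) set)"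
  by (rule finite_subset[OF _ finite_set_of_finite_funs[of X UNIV 1]]) (auto simp: characters_def)

definition assignments :: "(nat list \<Rightarrow> 'g) set" where
  "assignments = {\<sigma>. \<forall>v. \<sigma> v \<in> X}"

context
  fixes u :: "nat list" and x :: "nat \<Rightarrow> nat \<Rightarrow> 'g \<Rightarrow> 'a::idom"
  assumes x: "\<And>s s'. x s s' \<in> characters"
begin

lemma path_monomial_mul:
  assumes "\<sigma> \<in> assignments" and "\<tau> \<in> assignments"
  shows "path_monomial u x ks (\<lambda>v. mul (\<sigma> v) (\<tau> v)) = path_monomial u x ks \<sigma> * path_monomial u x ks \<tau>"
proof -
  have "x s s' (mul (\<sigma> v) (\<tau> v)) = x s s' (\<sigma> v) * x s s' (\<tau> v)" for s s' v
    using x[of s s'] assms by (simp add: characters_def assignments_def)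
  then show ?thesis unfolding path_monomial_def by (auto simp: prod.distrib[symmetric] intro!: prod.cong)
qed

text \<open>All other variables are set to \<open>unit\<close>, where characters are 1, so only the
  share of the variable at \<open>t\<close> is left.\<close>

lemma variable_part_eq_path_monomial:
  assumes "t < length u" and "u ! t = 3"
  shows "variable_part u x ks t g =
    path_monomial u x ks (\<lambda>v. if v = name_at u t then g else unit)"
proof -
  have "x s s' unit = 1" for s s' using x[of s s'] by (simp add: characters_def)
  then show ?thesis unfolding variable_part_def path_monomial_def
    using assms by (auto intro!: prod.cong)
qed

lemma path_monomial_eq_prod_variable_parts:
  obtains t where "\<And>v. v \<in> name_at u ` {p. p < length u \<and> u ! p = 3} \<Longrightarrow> t v < length u"
    and "\<And>ks \<sigma>. path_monomial u x ks \<sigma> =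
      (\<Prod>v\<in>name_at u ` {p. p < length u \<and> u ! p = 3}. variable_part u x ks (t v) (\<sigma> v))"
proof -
  let ?S = "{p. p < length u \<and> u ! p = 3}"
  define t where "t v = (SOME p. p \<in> ?S \<and> name_at u p = v)" for v
  have t: "t v \<in> ?S" "name_at u (t v) = v" if "v \<in> name_at u ` ?S" for v
    using that someI_ex[of "\<lambda>p. p \<in> ?S \<and> name_at u p = v"] unfolding t_def by auto
  have "path_monomial u x ks \<sigma> = (\<Prod>v\<in>name_at u ` ?S. variable_part u x ks (t v) (\<sigma> v))" for ks \<sigma>
  proof -
    have "path_monomial u x ks \<sigma> = (\<Prod>p\<in>?S. x (below ks p) (below ks (Suc p)) (\<sigma> (name_at u p)))"
      unfolding path_monomial_def by (subst prod.inter_filter[symmetric]) (auto simp: lessThan_def)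
    also have "\<dots> = (\<Prod>v\<in>name_at u ` ?S. \<Prod>p\<in>{p \<in> ?S. name_at u p = v}. x (below ks p) (below ks (Suc p)) (\<sigma> (name_at u p)))"
      by (rule prod.image_gen) simp
    also have "\<dots> = (\<Prod>v\<in>name_at u ` ?S. variable_part u x ks (t v) (\<sigma> v))"
    proof (rule prod.cong[OF refl])
      fix v assume v: "v \<in> name_at u ` ?S"
      show "(\<Prod>p\<in>{p \<in> ?S. name_at u p = v}. x (below ks p) (below ks (Suc p)) (\<sigma> (name_at u p))) =
          variable_part u x ks (t v) (\<sigma> v)"
        unfolding variable_part_def using t[OF v]
        by (subst prod.inter_filter[symmetric]) (auto simp: lessThan_def intro!: prod.cong)
    qed
    finally show ?thesis .
  qed
  then show ?thesis using that t(1) by blast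
qed

text \<open>A monomial is the product of its shares, and each share is recovered by setting the
  other variables to \<open>unit\<close>.\<close>

lemma same_monomial_iff:
  "(\<forall>t<length u. variable_part u x ks t = variable_part u x ks' t) \<longleftrightarrow>
     (\<forall>\<sigma>\<in>assignments. path_monomial u x ks \<sigma> = path_monomial u x ks' \<sigma>)"
proof
  assume eq: "\<forall>t<length u. variable_part u x ks t = variable_part u x ks' t"
  show "\<forall>\<sigma>\<in>assignments. path_monomial u x ks \<sigma> = path_monomial u x ks' \<sigma>"
    by (rule path_monomial_eq_prod_variable_parts) (simp add: eq cong: prod.cong)
next
  assume eq: "\<forall>\<sigma>\<in>assignments. path_monomial u x ks \<sigma> = path_monomial u x ks' \<sigma>"
  show "\<forall>t<length u. variable_part u x ks t = variable_part u x ks' t"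
  proof (intro allI impI ext)
    fix t g assume t: "t < length u"
    have trivial: "x s s' g = 1" if "g \<notin> X" for s s' using x[of s s'] that by (simp add: characters_def)
    have assignment: "(\<lambda>v. if v = name_at u t then g else unit) \<in> assignments" if "g \<in> X"
      using that unit_closed by (simp add: assignments_def)
    show "variable_part u x ks t g = variable_part u x ks' t g"
    proof (cases "u ! t = 3 \<and> g \<in> X")
      case True
      then show ?thesis using eq assignment variable_part_eq_path_monomial[OF t] by simp
    next
      case False
      then have "variable_part u x ks t g = 1" for ks
        unfolding variable_part_def by (intro prod.neutral) (auto simp: trivial)
      then show ?thesis by simp
    qed
  qed
qed

theorem nonvanishing_iff_path_test:
  assumes "\<And>a s s'. s' < s \<Longrightarrow> c a s s' = 0"
  shows "(\<exists>\<sigma>\<in>assignments. run (Suc K) c x (\<lambda>s. of_bool (s = K)) \<sigma> u 0 \<noteq> 0) \<longleftrightarrow> path_test u K c x"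
proof -
  let ?T = "tuples K (length u)"
  \<comment> \<open>Cut off to 0 outside \<open>assignments\<close>, so that monomials that agree
    there are equal as functions and terms can be collected by the value of
    \<open>mon\<close>.\<close>
  define mon where "mon ks = (\<lambda>\<sigma>. if \<sigma> \<in> assignments then path_monomial u x ks \<sigma> else 0)" for ks
  define coeff where "coeff h = (\<Sum>ks\<in>{ks \<in> ?T. mon ks = h}. path_coeff u c ks)" for h
  have same: "mon ks = mon ks' \<longleftrightarrow> (\<forall>t<length u. variable_part u x ks t = variable_part u x ks' t)" for ks ks'
    unfolding same_monomial_iff mon_def by (auto simp: fun_eq_iff)
  have coeff: "(\<Sum>ks'\<in>?T. if \<forall>t<length u. variable_part u x ks t = variable_part u x ks' t
      then path_coeff u c ks' else 0) = coeff (mon ks)" for ks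
    unfolding coeff_def same[symmetric]
    by (subst sum.inter_filter[symmetric]) (auto intro!: sum.cong)
  have run: "run (Suc K) c x (\<lambda>s. of_bool (s = K)) \<sigma> u 0 = (\<Sum>h\<in>mon ` ?T. coeff h * h \<sigma>)"
    if "\<sigma> \<in> assignments" for \<sigma>
  proof -
    have "run (Suc K) c x (\<lambda>s. of_bool (s = K)) \<sigma> u 0 = (\<Sum>ks\<in>?T. path_coeff u c ks * mon ks \<sigma>)"
      using that run_eq_sum_monomials[of c K x \<sigma> u] assms by (simp add: mon_def)
    also have "\<dots> = (\<Sum>h\<in>mon ` ?T. \<Sum>ks\<in>{ks \<in> ?T. mon ks = h}. path_coeff u c ks * mon ks \<sigma>)"
      by (rule sum.image_gen) simp
    also have "\<dots> = (\<Sum>h\<in>mon ` ?T. coeff h * h \<sigma>)"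
      unfolding coeff_def sum_distrib_right by (auto intro!: sum.cong)
    finally show ?thesis .
  qed
  have "(\<forall>\<sigma>\<in>assignments. (\<Sum>h\<in>mon ` ?T. coeff h * h \<sigma>) = 0) \<longleftrightarrow> (\<forall>ks\<in>?T. coeff (mon ks) = 0)"
  proof
    assume zero: "\<forall>\<sigma>\<in>assignments. (\<Sum>h\<in>mon ` ?T. coeff h * h \<sigma>) = 0"
    show "\<forall>ks\<in>?T. coeff (mon ks) = 0"
    proof
      fix ks assume ks: "ks \<in> ?T"
      \<comment> \<open>At the constant assignment \<open>unit\<close> every monomial is 1, so none
        vanishes identically.\<close>
      have unit: "path_monomial u x ks (\<lambda>_. unit) = 1" for ks
      proof -
        have "x s s' unit = 1" for s s' using x[of s s'] by (simp add: characters_def)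
        then show ?thesis unfolding path_monomial_def by (intro prod.neutral) auto
      qed
      show "coeff (mon ks) = 0"
      proof (rule multiplicative_independent[where H = "mon ` ?T" and X = assignments
            and mul = "\<lambda>\<sigma> \<tau> v. mul (\<sigma> v) (\<tau> v)" and a = coeff])
        show "\<exists>\<sigma>\<in>assignments. h \<sigma> \<noteq> 0" if "h \<in> mon ` ?T" for h
          using that unit unit_closed by (intro bexI[of _ "\<lambda>_. unit"]) (auto simp: mon_def assignments_def)
        show "h = h'" if "h \<in> mon ` ?T" "h' \<in> mon ` ?T" "\<forall>\<sigma>\<in>assignments. h \<sigma> = h' \<sigma>" for h h'
          using that by (auto simp: mon_def fun_eq_iff)
        show "h (\<lambda>v. mul (\<sigma> v) (\<tau> v)) = h \<sigma> * h \<tau>"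
          if "h \<in> mon ` ?T" "\<sigma> \<in> assignments" "\<tau> \<in> assignments" for h \<sigma> \<tau>
          using that path_monomial_mul mul_closed by (auto simp: mon_def assignments_def)
      qed (use zero ks mul_closed in \<open>auto simp: assignments_def\<close>)
    qed
  qed (auto intro!: sum.neutral)
  then show ?thesis using run unfolding path_test_def coeff by auto
qed

end

end

section \<open>Definability of the path test\<close>

definition block :: "(nat \<Rightarrow> nat) \<Rightarrow> nat \<Rightarrow> nat \<Rightarrow> nat list" where
  "block e l K = map e [l..<l + K]"

lemma length_block [simp]: "length (block e l K) = K"
  by (simp add: block_def)

lemma block_nth: "u < K \<Longrightarrow> block e l K ! u = e (l + u)"
  by (simp add: block_def)

lemma block_update [simp]: "l + K \<le> n \<Longrightarrow> block (e(n := p)) l K = block e l K"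
  by (simp add: block_def)

lemma block_extend: "length ks = K \<Longrightarrow> block (extend e n ks) n K = ks"
  by (rule nth_equalityI) (simp_all add: block_nth extend_inside)

lemma block_extend_before: "l + K \<le> n \<Longrightarrow> block (extend e n ks) l K = block e l K"
  by (simp add: block_def extend_outside)

lemma below_eq_sum: "below ks p = (\<Sum>u<length ks. of_bool (ks ! u < p))"
proof -
  have "{u. u < length ks \<and> ks ! u < p} = {u \<in> {..<length ks}. ks ! u < p}" by auto
  then show ?thesis by (simp add: below_def length_filter_conv_card sum.inter_filter[symmetric] of_bool_def)
qed

lemma definable_below: "definable Z n (\<lambda>w e. below (block e l K) (e p))"
proof -
  have "definable Z n (\<lambda>w e. \<Sum>u<K. of_bool (e (l + u) < e p) :: nat)"
    by (intro definable_finite_sum definable_map[where F = of_bool] definable_less)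
  then show ?thesis by (simp add: below_eq_sum block_nth)
qed

text \<open>Pointers can only be compared with each other; \<open>k < Suc p\<close> is therefore
  expressed as \<open>\<not> p < k\<close>.\<close>

lemma definable_below_Suc: "definable Z n (\<lambda>w e. below (block e l K) (Suc (e p)))"
proof -
  have "definable Z n (\<lambda>w e. \<Sum>u<K. of_bool (\<not> e p < e (l + u)) :: nat)"
    by (intro definable_finite_sum definable_map[where F = "\<lambda>b. of_bool (\<not> b)"] definable_less)
  then show ?thesis by (simp add: below_eq_sum block_nth not_less less_Suc_eq_le)
qed

lemma definable_sorted: "definable Z n (\<lambda>w e. sorted (block e l K))"
proof -
  have "definable Z n (\<lambda>w e. \<forall>u<K - 1. \<not> e (l + Suc u) < e (l + u))"
    by (intro definable_finite_all definable_map[where F = Not] definable_less)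
  moreover have "sorted (block e l K) \<longleftrightarrow> (\<forall>u<K - 1. \<not> e (l + Suc u) < e (l + u))" for e
  proof -
    have "u < K - 1 \<longleftrightarrow> Suc u < K" for u by auto
    then show ?thesis unfolding sorted_iff_nth_Suc length_block
      by (intro iff_allI) (simp add: block_nth not_less cong: imp_cong)
  qed
  ultimately show ?thesis by simp
qed

lemma length_padded [simp]: "length (padded Z w) = length w + 2"
  by (simp add: padded_def)

lemma padded_nth: "p < length w + 2 \<Longrightarrow> padded Z w ! p = pad_sym Z w p"
  by (simp add: pad_sym_def)

lemma definable_path_coeff:
  fixes c :: "nat \<Rightarrow> nat \<Rightarrow> nat \<Rightarrow> 'a::{comm_ring_1,finite}"
  assumes "l + K \<le> n"
  shows "definable Z n (\<lambda>w e. path_coeff (padded Z w) c (block e l K))"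
proof -
  define \<Phi> where "\<Phi> w e = c (pad_sym Z w (e n)) (below (block e l K) (e n)) (below (block e l K) (Suc (e n)))"
    for w and e :: "nat \<Rightarrow> nat"
  have "definable Z (Suc n) \<Phi>"
    unfolding \<Phi>_def
    by (rule definable_map2[where F = "\<lambda>f. f" and \<Phi> = "\<lambda>w e. c (pad_sym Z w (e n)) (below (block e l K) (e n))"])
      (intro definable_map2[where F = c] definable_sym definable_below definable_below_Suc)+
  from definable_map2[OF definable_sorted definable_prod[OF this], of "\<lambda>b y. if b then y else 0" l K]
  show ?thesis
    by (rule definable_cong) (auto simp: path_coeff_def \<Phi>_def assms padded_nth intro!: prod.cong)
qed

lemma definable_variable_part:
  fixes x :: "nat \<Rightarrow> nat \<Rightarrow> 'g \<Rightarrow> 'a::comm_ring_1"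
  assumes "l + K \<le> n" and "t < n" and B: "finite B" "(\<lambda>_. 1) \<in> B" "\<And>s s'. x s s' \<in> B"
    "\<And>h h'. h \<in> B \<Longrightarrow> h' \<in> B \<Longrightarrow> (\<lambda>g. h g * h' g) \<in> B"
  shows "definable Z n (\<lambda>w e. variable_part (padded Z w) x (block e l K) (e t))"
proof -
  define \<Phi> where "\<Phi> w e = (if pad_sym Z w (e n) = 3 \<and> pad_sym Z w (e t) = 3 \<and>
        name_at (padded Z w) (e n) = name_at (padded Z w) (e t)
      then x (below (block e l K) (e n)) (below (block e l K) (Suc (e n))) else (\<lambda>_. 1))"
    for w and e :: "nat \<Rightarrow> nat"
  have "definable Z (Suc n) \<Phi>"
    unfolding \<Phi>_def
    by (intro definable_map2[where F = "\<lambda>b y. if b then y else (\<lambda>_. 1)"] definable_same_name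
        definable_map2[where F = x] definable_below definable_below_Suc)
  moreover have "\<Phi> w e \<in> B" for w e using B by (simp add: \<Phi>_def)
  ultimately have "definable Z n (\<lambda>w e g. \<Prod>p<length w + 2. \<Phi> w (e(n := p)) g)"
    using B by (intro definable_prod_fun[of Z n \<Phi> B]) auto
  then show ?thesis
  proof (rule definable_cong)
    fix w and e :: "nat \<Rightarrow> nat" assume "valid Z w e"
    then show "(\<lambda>g. \<Prod>p<length w + 2. \<Phi> w (e(n := p)) g) = variable_part (padded Z w) x (block e l K) (e t)"
      by (intro ext, unfold variable_part_def length_padded, intro prod.cong refl)
        (use assms(1,2) in \<open>auto simp: \<Phi>_def padded_nth valid_def\<close>)
  qed
qed

text \<open>Pointers 0 to \<open>K - 1\<close> hold the tuple \<open>ks\<close>, \<open>K\<close> to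
  \<open>2 * K - 1\<close> the tuple \<open>ks'\<close>, and \<open>2 * K\<close> is
  \<open>t\<close>; the products bind the next free pointer.\<close>

theorem definable_path_test:
  fixes c :: "nat \<Rightarrow> nat \<Rightarrow> nat \<Rightarrow> 'a::{comm_ring_1,finite}" and x :: "nat \<Rightarrow> nat \<Rightarrow> 'g \<Rightarrow> 'a"
  assumes B: "finite B" "(\<lambda>_. 1) \<in> B" "\<And>s s'. x s s' \<in> B"
    "\<And>h h'. h \<in> B \<Longrightarrow> h' \<in> B \<Longrightarrow> (\<lambda>g. h g * h' g) \<in> B"
  shows "definable Z 0 (\<lambda>w e. path_test (padded Z w) K c x)"
proof -
  let ?part = "\<lambda>w ks t. variable_part (padded Z w) x ks t"
  let ?same = "\<lambda>w ks ks'. \<forall>t<length w + 2. ?part w ks t = ?part w ks' t"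
  have "definable Z (Suc (K + K)) (\<lambda>w e. ?part w (block e 0 K) (e (K + K)) = ?part w (block e K K) (e (K + K)))"
    by (intro definable_map2[where F = "(=)"] definable_variable_part[where B = B] B) auto
  from definable_all[OF this]
  have "definable Z (K + K) (\<lambda>w e. ?same w (block e 0 K) (block e K K))"
    by simp
  from definable_map2[OF this definable_path_coeff[of K K "K + K" Z c], of "\<lambda>b y. if b then y else 0"]
  have "definable Z (K + K) (\<lambda>w e. if ?same w (block e 0 K) (block e K K)
      then path_coeff (padded Z w) c (block e K K) else 0)"
    by simp
  from definable_map[OF definable_sum_tuples[OF this], of "\<lambda>y. y \<noteq> 0"]
  have "definable Z K (\<lambda>w e. (\<Sum>ks'\<in>tuples K (length w + 2).
      if ?same w (block e 0 K) ks' then path_coeff (padded Z w) c ks' else 0) \<noteq> 0)"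
    by (rule definable_cong, intro arg_cong[where f = "\<lambda>y. y \<noteq> 0"] sum.cong refl)
      (auto simp: tuples_def block_extend block_extend_before)
  then have "definable Z (0 + K) (\<lambda>w e. (\<Sum>ks'\<in>tuples K (length w + 2).
      if ?same w (block e 0 K) ks' then path_coeff (padded Z w) c ks' else 0) \<noteq> 0)" by simp
  from definable_ex_tuples[OF this]
  show ?thesis
    by (rule definable_cong, unfold path_test_def length_padded, intro bex_cong refl)
      (auto simp: tuples_def block_extend)
qed

theorem (in mult_structure) recognizable_nonvanishing_in_P:
  fixes \<Phi> :: "(nat list \<Rightarrow> 'g) \<Rightarrow> nat list \<Rightarrow> 'a::{field,finite}"
  assumes "recognizable characters \<Phi>" and "finite X" and "3 < Z"
  obtains M p where "wf_tm M" and
    "\<And>w. set w \<subseteq> {1..<Z} \<Longrightarrow> answers_within M w (\<exists>\<sigma>\<in>assignments. \<Phi> \<sigma> w \<noteq> 0) (poly p (length w))"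
proof -
  obtain K c x where x: "\<And>s s'. x s s' \<in> characters" and c: "\<And>a s s'. s' < s \<Longrightarrow> c a s s' = 0"
    and \<Phi>: "\<And>\<sigma> w. set w \<subseteq> {1..<Z} \<Longrightarrow>
      \<Phi> \<sigma> w = run (Suc K) c x (\<lambda>s. of_bool (s = K)) \<sigma> (padded Z w) 0"
    by (rule recognizable_padded[OF assms(1,3)]) (rule that)
  have "definable Z 0 (\<lambda>w e. path_test (padded Z w) K c x)"
    using finite_characters[OF assms(2)] one_in_characters x mult_in_characters
    by (rule definable_path_test)
  then obtain M p where M: "wf_tm M"
    "\<And>w. set w \<subseteq> {1..<Z} \<Longrightarrow> answers_within M w (path_test (padded Z w) K c x) (poly p (length w))"
    by (rule definable_decidable) (use assms(3) in auto)
  show ?thesis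
  proof (rule that[OF M(1)])
    fix w :: "nat list" assume w: "set w \<subseteq> {1..<Z}"
    show "answers_within M w (\<exists>\<sigma>\<in>assignments. \<Phi> \<sigma> w \<noteq> 0) (poly p (length w))"
      using M(2)[OF w] nonvanishing_iff_path_test[of x c, OF x c] by (simp add: \<Phi>[OF w])
  qed
qed

section \<open>Semipattern groups\<close>

locale semipattern =
  fixes m :: nat and P :: "(nat \<times> nat) set" and S :: "nat \<Rightarrow> 'a::{field,finite} set"
    and G :: "'a mat monoid"
  assumes P: "P \<subseteq> {(i, j). i < j \<and> j < m}"
    and S: "\<And>i. i < m \<Longrightarrow> subgroup (S i) field_units"
    and G: "G = (triangular_group m)
      \<lparr>carrier := pattern_set m P <#>\<^bsub>triangular_group m\<^esub> diagonal_set m S\<rparr>"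
begin

definition support :: "(nat \<times> nat) set" where
  "support = {(i, j). i < m \<and> j < m \<and> (i = j \<or> (i, j) \<in> P)}"

lemma support_upper: "(i, j) \<in> support \<Longrightarrow> i \<le> j \<and> j < m"
  using P by (auto simp: support_def)

lemma S_nonzero: "i < m \<Longrightarrow> a \<in> S i \<Longrightarrow> a \<noteq> 0"
  and S_one: "i < m \<Longrightarrow> 1 \<in> S i"
  and S_mult: "i < m \<Longrightarrow> a \<in> S i \<Longrightarrow> b \<in> S i \<Longrightarrow> a * b \<in> S i"
  using subgroup.subset[OF S] subgroup.one_closed[OF S] subgroup.m_closed[OF S]
  by (fastforce simp: field_units_def)+

lemma carrier_eq: "carrier G = {N * D |N D. N \<in> pattern_set m P \<and> D \<in> diagonal_set m S}"
  by (auto simp: G set_mult_def triangular_group_def)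

text \<open>A diagonal factor on the right scales column \<open>j\<close> by its \<open>j\<close>-th
  entry, so dividing each column by the diagonal entry splits the matrix again. Membership becomes a
  condition on single entries, which entrywise multiplication respects.\<close>

lemma carrier_iff:
  "A \<in> carrier G \<longleftrightarrow> A \<in> carrier_mat m m \<and> (\<forall>i<m. A $$ (i, i) \<in> S i) \<and>
     (\<forall>i<m. \<forall>j<m. (i, j) \<notin> support \<longrightarrow> A $$ (i, j) = 0)" (is "_ \<longleftrightarrow> ?R A")
proof
  assume "A \<in> carrier G"
  then obtain a s where s: "\<And>i. i < m \<Longrightarrow> s i \<in> S i" and
    A: "A = mat m m (\<lambda>(i, j). (if i = j then 1 else 0) + (if (i, j) \<in> P then a i j else 0)) * mat_diag m s"
    by (auto simp: carrier_eq pattern_set_def diagonal_set_def)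
  have "A = mat m m (\<lambda>(i, j). ((if i = j then 1 else 0) + (if (i, j) \<in> P then a i j else 0)) * s j)"
    unfolding A by (subst mat_diag_mult_right[of _ m]) (auto intro!: eq_matI)
  then show "?R A" using s P by (auto simp: support_def)
next
  assume R: "?R A"
  define a where "a i j = A $$ (i, j) / A $$ (j, j)" for i j
  define s where "s i = A $$ (i, i)" for i
  let ?N = "mat m m (\<lambda>(i, j). (if i = j then 1 else 0) + (if (i, j) \<in> P then a i j else 0))"
  have "?N * mat_diag m s =
      mat m m (\<lambda>(i, j). ((if i = j then 1 else 0) + (if (i, j) \<in> P then a i j else 0)) * s j)"
    by (subst mat_diag_mult_right[of _ m]) (auto intro!: eq_matI)
  also have "\<dots> = A"
  proof (rule eq_matI)
    fix i j assume "i < dim_row A" "j < dim_col A"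
    then have ij: "i < m" "j < m" using R by auto
    have "A $$ (j, j) \<noteq> 0" using S_nonzero[OF ij(2), of "A $$ (j, j)"] R ij by simp
    then show "mat m m (\<lambda>(i, j). ((if i = j then 1 else 0) + (if (i, j) \<in> P then a i j else 0)) * s j) $$ (i, j) = A $$ (i, j)"
      using R ij P by (auto simp: a_def s_def support_def)
  qed (use R in auto)
  finally have "A = ?N * mat_diag m s" ..
  moreover have "?N \<in> pattern_set m P" unfolding pattern_set_def by blast
  moreover have "mat_diag m s \<in> diagonal_set m S" using R by (auto simp: diagonal_set_def s_def)
  ultimately show "A \<in> carrier G" unfolding carrier_eq by blast
qed

lemma carrier_mat: "A \<in> carrier G \<Longrightarrow> A \<in> carrier_mat m m"
  by (simp add: carrier_iff)

lemma entry_zero: "A \<in> carrier G \<Longrightarrow> i < m \<Longrightarrow> j < m \<Longrightarrow> (i, j) \<notin> support \<Longrightarrow> A $$ (i, j) = 0"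
  by (simp add: carrier_iff)

definition entrywise :: "'a mat \<Rightarrow> 'a mat \<Rightarrow> 'a mat" where
  "entrywise A B = mat m m (\<lambda>(i, j). A $$ (i, j) * B $$ (i, j))"

definition entrywise_unit :: "'a mat" where
  "entrywise_unit = mat m m (\<lambda>ij. of_bool (ij \<in> support))"

sublocale mult_structure "carrier G" entrywise entrywise_unit
proof
  show "entrywise A B \<in> carrier G" if "A \<in> carrier G" "B \<in> carrier G" for A B
    using that S_mult by (simp add: carrier_iff entrywise_def)
  show "entrywise_unit \<in> carrier G"
    using S_one by (simp add: carrier_iff entrywise_unit_def support_def)
qed

text \<open>Off the support the matrix entry is 0, whereas a character is 1 at the unit; it is
  replaced by 1 here, and the coefficient \<open>letter\<close> supplies the 0.\<close>

definition entry :: "nat \<Rightarrow> nat \<Rightarrow> 'a mat \<Rightarrow> 'a" where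
  "entry i j A = (if (i, j) \<in> support \<and> A \<in> carrier G then A $$ (i, j) else 1)"

lemma entry_in_characters: "entry i j \<in> characters"
proof (cases "(i, j) \<in> support")
  case True
  then have "i < m" "j < m" by (auto simp: support_def)
  then show ?thesis using True unit_closed mul_closed unfolding characters_def
    by (auto simp: entry_def) (auto simp: entrywise_def entrywise_unit_def)
qed (simp add: characters_def entry_def)

lemma mult_entry:
  assumes "A \<in> carrier_mat m m" and "B \<in> carrier_mat m m" and "i < m" and "j < m"
  shows "(A * B) $$ (i, j) = (\<Sum>k<m. A $$ (i, k) * B $$ (k, j))"
  using assms by (simp add: scalar_prod_def atLeast0LessThan)

lemma expr_value_Nil: "expr_value G \<rho> [] = 1\<^sub>m m"
  and expr_value_Cons: "expr_value G \<rho> (t # f) = factor_value \<rho> t * expr_value G \<rho> f"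
  by (simp_all add: expr_value_def G triangular_group_def)

lemma factor_value_carrier:
  "t # f \<in> group_exprs G \<Longrightarrow> (\<And>v. \<rho> v \<in> carrier G) \<Longrightarrow> factor_value \<rho> t \<in> carrier G"
  by (cases t) (auto simp: group_exprs_def)

lemma expr_value_carrier_mat:
  assumes "f \<in> group_exprs G" and \<rho>: "\<And>v. \<rho> v \<in> carrier G"
  shows "expr_value G \<rho> f \<in> carrier_mat m m"
  using assms(1)
proof (induction f)
  case (Cons t f)
  then have "f \<in> group_exprs G" by (auto simp: group_exprs_def)
  then show ?case using Cons factor_value_carrier[OF Cons.prems \<rho>]
    by (simp add: expr_value_Cons carrier_mat[THEN mult_carrier_mat])
qed (simp add: expr_value_Nil)

end

section \<open>Skipping letters, and the encoding of the input\<close>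

lemma run_identity:
  assumes "\<And>a g s'. a \<in> set u \<Longrightarrow> s' < R \<Longrightarrow> step_weight c x a g s s' = of_bool (s' = s)" and "s < R"
  shows "run R c x b \<sigma> (u @ w) s = run R c x b \<sigma> w s"
  using assms(1)
proof (induction u)
  case (Cons a u)
  have "run R c x b \<sigma> ((a # u) @ w) s = (\<Sum>s'<R. of_bool (s' = s) * run R c x b \<sigma> (u @ w) s')"
    using Cons.prems by (auto intro!: sum.cong)
  also have "\<dots> = run R c x b \<sigma> (u @ w) s"
    using assms(2) by (simp add: of_bool_def if_distrib[of "\<lambda>y. y * _"] sum.delta' cong: if_cong)
  finally show ?case using Cons by simp
qed simp

lemma digit_binary: "set (binary n) \<subseteq> {1, 2}"
  by (induction n rule: binary.induct) (subst binary.simps, auto)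

lemma binary_inject: "binary n = binary k \<Longrightarrow> n = k"
proof (induction n arbitrary: k rule: less_induct)
  case (less n)
  show ?case
  proof (cases "n = 0 \<or> k = 0")
    case True
    then show ?thesis using less.prems by (subst (asm) binary.simps, subst (asm) (2) binary.simps) (auto split: if_splits)
  next
    case False
    then have eq: "(if even n then 1 else 2) # binary (n div 2) = (if even k then 1 else 2) # binary (k div 2)"
      using less.prems binary.simps[of n] binary.simps[of k] by simp
    then have "n div 2 = k div 2" using less.IH[of "n div 2" "k div 2"] False by simp
    moreover have "even n \<longleftrightarrow> even k" using eq by (auto split: if_splits)
    ultimately show ?thesis by (metis even_two_times_div_two odd_two_times_div_two_succ)
  qed
qed

lemma length_binary_le: "length (binary n) \<le> n"
proof (induction n rule: less_induct)
  case (less n)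
  show ?case using less.IH[of "n div 2"] by (cases "n = 0") (simp_all add: binary.simps[of n] binary.simps[of 0])
qed

lemma takeWhile_digit_append:
  assumes "set u \<subseteq> {1, 2}" and "w = [] \<or> \<not> digit (hd w)"
  shows "takeWhile digit (u @ w) = u"
  using assms by (induction u) (cases w; auto simp: digit_def)+

definition encode_expr :: "('g \<Rightarrow> nat) \<Rightarrow> 'g group_expr \<Rightarrow> nat list" where
  "encode_expr code f = concat (map (encode_factor code) f)"

lemma encode_equation_eq: "encode_equation code f g = encode_expr code f @ 4 # encode_expr code g"
  by (simp add: encode_equation_def encode_expr_def)

lemma encode_expr_no_separator: "4 \<notin> set (encode_expr code f)"
proof -
  have "4 \<notin> set (encode_factor code t)" for t
    using digit_binary by (cases t) fastforce+
  then show ?thesis by (auto simp: encode_expr_def)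
qed

section \<open>Automata for the matrix entries of both sides\<close>

locale semipattern_coding = semipattern +
  fixes code :: "'a mat \<Rightarrow> nat"
  assumes code: "bij_betw code (carrier G) {..<card (carrier G)}"
begin

definition decode :: "nat \<Rightarrow> 'a mat" where
  "decode = inv_into (carrier G) code"

lemma decode_code: "A \<in> carrier G \<Longrightarrow> decode (code A) = A"
  using code by (simp add: decode_def bij_betw_inv_into_left)

text \<open>The matrix by which a letter multiplies, up to the variable factor
  \<open>side_entry\<close>: for 3 only the mask of the support. Digits act as the identity, so that
  names are passed without effect.\<close>

definition letter :: "nat \<Rightarrow> nat \<Rightarrow> nat \<Rightarrow> 'a" where
  "letter a i j =
     (if a = 3 then of_bool ((i, j) \<in> support)
      else if 5 \<le> a then if (i, j) \<in> support then decode (a - 5) $$ (i, j) else 0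
      else of_bool (i = j))"

text \<open>
  The states below \<open>m\<close> are used before the separator, the others after it; the flag tells whether the
  left side of the equation is multiplied out and the right side is skipped, or vice versa.
\<close>

definition side_coeff :: "bool \<Rightarrow> nat \<Rightarrow> nat \<Rightarrow> nat \<Rightarrow> 'a" where
  "side_coeff left a s s' =
     (if a = 4 then of_bool (s < m \<and> s' = s + m)
      else if s < m \<and> s' < m then if left then letter a s s' else of_bool (s = s')
      else if m \<le> s \<and> m \<le> s' then if left then of_bool (s = s') else letter a (s - m) (s' - m)
      else 0)"

definition side_entry :: "bool \<Rightarrow> nat \<Rightarrow> nat \<Rightarrow> 'a mat \<Rightarrow> 'a" where
  "side_entry left s s' =
     (if left \<and> s < m \<and> s' < m then entry s s'
      else if \<not> left \<and> m \<le> s \<and> m \<le> s' then entry (s - m) (s' - m) else (\<lambda>_. 1))"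

definition side_run :: "bool \<Rightarrow> nat \<Rightarrow> (nat list \<Rightarrow> 'a mat) \<Rightarrow> nat list \<Rightarrow> nat \<Rightarrow> 'a" where
  "side_run left j = run (m + m) (side_coeff left) (side_entry left) (\<lambda>s. of_bool (s = m + j))"

lemma recognizable_side:
  assumes i: "i < m"
  shows "recognizable characters (\<lambda>\<sigma> w. side_run left j \<sigma> w i)"
proof (rule recognizableI[where R = "m + m" and c = "side_coeff left" and x = "side_entry left"
      and i = "\<lambda>s. of_bool (s = i)" and b = "\<lambda>s. of_bool (s = m + j)"])
  show "0 < m + m" using i by simp
  show "side_entry left s s' \<in> characters" for s s'
    by (simp add: side_entry_def entry_in_characters one_in_characters)
  have "letter a s s' = 0" if "s' < s" for a s s'
    using that support_upper[of s s'] by (auto simp: letter_def)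
  then show "side_coeff left a s s' = 0" if "s' < s" for a s s'
    using that by (auto simp: side_coeff_def)
  show "side_run left j \<sigma> w i = (\<Sum>s<m + m. of_bool (s = i) *
      run (m + m) (side_coeff left) (side_entry left) (\<lambda>s. of_bool (s = m + j)) \<sigma> w s)" for \<sigma> w
    using i by (simp add: side_run_def of_bool_def if_distrib[of "\<lambda>y. y * _"] sum.delta' cong: if_cong)
qed

text \<open>The first of the states in which matrices are multiplied.\<close>

definition base :: "bool \<Rightarrow> nat" where
  "base left = (if left then 0 else m)"

lemma side_run_Cons:
  assumes "a \<noteq> 4" and "i < m" and "\<sigma> (takeWhile digit w) \<in> carrier G"
  shows "side_run left j \<sigma> (a # w) (base left + i) =
    (\<Sum>k<m. (if a = 3 then \<sigma> (takeWhile digit w) $$ (i, k) else letter a i k) * side_run left j \<sigma> w (base left + k))"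
proof -
  let ?g = "\<sigma> (takeWhile digit w)"
  have weight: "step_weight (side_coeff left) (side_entry left) a ?g (base left + i) (base left + k) =
      (if a = 3 then ?g $$ (i, k) else letter a i k)" if "k < m" for k
    using that assms entry_zero[of ?g i k]
    by (auto simp: step_weight_def side_coeff_def side_entry_def base_def letter_def entry_def)
  \<comment> \<open>Only the separator 4 leads from one half of the states to the other.\<close>
  have other: "step_weight (side_coeff left) (side_entry left) a ?g (base left + i) (m - base left + k) = 0" if "k < m" for k
    using that assms by (auto simp: step_weight_def side_coeff_def base_def)
  show ?thesis
  proof (cases left)
    case True
    then show ?thesis using weight other
      by (simp add: side_run_def sum_lessThan_add base_def)
  next
    case False
    then show ?thesis using weight other
      by (simp add: side_run_def sum_lessThan_add base_def)
  qed
qed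

lemma side_run_digits:
  assumes "set u \<subseteq> {1, 2}" and "i < m"
  shows "side_run left j \<sigma> (u @ w) (base left + i) = side_run left j \<sigma> w (base left + i)"
  unfolding side_run_def
proof (rule run_identity)
  fix a g s' assume "a \<in> set u" "s' < m + m"
  then have "a = 1 \<or> a = 2" using assms(1) by auto
  then show "step_weight (side_coeff left) (side_entry left) a g (base left + i) s' = of_bool (s' = base left + i)"
    using assms(2) \<open>s' < m + m\<close> by (auto simp: step_weight_def side_coeff_def base_def letter_def)
qed (use assms(2) in \<open>auto simp: base_def\<close>)

text \<open>The condition on \<open>w\<close> prevents the name of a variable at the end of
  \<open>f\<close> from being continued by digits of \<open>w\<close>. Assignments are indexed by
  words, so variable \<open>v\<close> has the value at \<open>binary v\<close>.\<close>

lemma side_run_expr: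
  assumes "f \<in> group_exprs G" and \<sigma>: "\<sigma> \<in> assignments" and "i < m" and w: "w = [] \<or> hd w = 4"
  shows "side_run left j \<sigma> (encode_expr code f @ w) (base left + i) =
    (\<Sum>k<m. expr_value G (\<lambda>v. \<sigma> (binary v)) f $$ (i, k) * side_run left j \<sigma> w (base left + k))"
  using assms(1,3)
proof (induction f arbitrary: i)
  case Nil
  then show ?case
    by (simp add: encode_expr_def expr_value_Nil of_bool_def if_distrib[of "\<lambda>y. y * _"] sum.delta cong: if_cong)
next
  case (Cons t f)
  let ?\<rho> = "\<lambda>v. \<sigma> (binary v)"
  have f: "f \<in> group_exprs G" using Cons.prems(1) by (auto simp: group_exprs_def)
  have \<rho>: "?\<rho> v \<in> carrier G" for v using \<sigma> by (simp add: assignments_def)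
  have t: "factor_value ?\<rho> t \<in> carrier G" using factor_value_carrier[OF Cons.prems(1) \<rho>] .
  have next_letter: "encode_expr code f @ w = [] \<or> \<not> digit (hd (encode_expr code f @ w))"
  proof (cases f)
    case Nil
    then show ?thesis using w by (auto simp: encode_expr_def digit_def)
  next
    case (Cons t' f')
    then show ?thesis by (cases t') (auto simp: encode_expr_def digit_def)
  qed
  have "side_run left j \<sigma> (encode_factor code t @ encode_expr code f @ w) (base left + i) =
      (\<Sum>l<m. factor_value ?\<rho> t $$ (i, l) * side_run left j \<sigma> (encode_expr code f @ w) (base left + l))"
  proof (cases t)
    case (Var v)
    have "takeWhile digit (binary v @ encode_expr code f @ w) = binary v"
      by (rule takeWhile_digit_append[OF digit_binary next_letter])
    then show ?thesis
      using Var Cons.prems(2) \<rho> side_run_Cons[of 3 i \<sigma> "binary v @ encode_expr code f @ w" left j]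
      by (simp add: side_run_digits[OF digit_binary])
  next
    case (Const A)
    have "A \<in> carrier G" using t Const by simp
    then have "letter (5 + code A) i l = A $$ (i, l)" if "l < m" for l
      using entry_zero[of A i l] Cons.prems(2) that by (simp add: letter_def decode_code)
    then show ?thesis
      using Const Cons.prems(2) \<sigma> side_run_Cons[of "5 + code A" i \<sigma> "encode_expr code f @ w" left j]
      by (simp add: assignments_def)
  qed
  also have "\<dots> = (\<Sum>l<m. \<Sum>k<m. factor_value ?\<rho> t $$ (i, l) * expr_value G ?\<rho> f $$ (l, k) * side_run left j \<sigma> w (base left + k))"
    using Cons.IH[OF f] by (intro sum.cong refl) (simp add: sum_distrib_left mult.assoc)
  also have "\<dots> = (\<Sum>k<m. expr_value G ?\<rho> (t # f) $$ (i, k) * side_run left j \<sigma> w (base left + k))"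
    using mult_entry[OF carrier_mat[OF t] expr_value_carrier_mat[OF f \<rho>]] Cons.prems(2)
    by (subst sum.swap) (simp add: expr_value_Cons sum_distrib_right)
  finally show ?case by (simp add: encode_expr_def)
qed

lemma side_run_separator: "i < m \<Longrightarrow> side_run left j \<sigma> (4 # w) i = side_run left j \<sigma> w (m + i)"
  unfolding side_run_def
  by (simp add: step_weight_def side_coeff_def add.commute of_bool_def if_distrib[of "\<lambda>y. y * _"] sum.delta sum.delta' cong: if_cong)

text \<open>\<open>m - base left\<close> is the first state of the half in which nothing is
  multiplied; there every letter but 4 acts as the identity.\<close>

lemma side_run_skip:
  assumes "4 \<notin> set u" and "i < m"
  shows "side_run left j \<sigma> (u @ w) (m - base left + i) = side_run left j \<sigma> w (m - base left + i)"
  unfolding side_run_def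
proof (rule run_identity)
  fix a g s' assume "a \<in> set u" "s' < m + m"
  moreover from this have "a \<noteq> 4" using assms(1) by auto
  ultimately show "step_weight (side_coeff left) (side_entry left) a g (m - base left + i) s' = of_bool (s' = m - base left + i)"
    using assms(2) by (auto simp: step_weight_def side_coeff_def side_entry_def base_def)
qed (use assms(2) in \<open>auto simp: base_def\<close>)

lemma sum_times_of_bool: "j < m \<Longrightarrow> (\<Sum>k<m. h k * of_bool (k = j)) = h j" for h :: "nat \<Rightarrow> 'a"
  by (simp add: of_bool_def if_distrib[of "\<lambda>y. _ * y"] sum.delta cong: if_cong)

lemma side_run_equation:
  assumes "f \<in> group_exprs G" and "g \<in> group_exprs G" and "\<sigma> \<in> assignments" and "i < m" and "j < m"
  shows "side_run left j \<sigma> (encode_equation code f g) i =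
    expr_value G (\<lambda>v. \<sigma> (binary v)) (if left then f else g) $$ (i, j)"
proof (cases left)
  case True
  have "side_run True j \<sigma> (encode_expr code g) (m + k) = of_bool (k = j)" if "k < m" for k
    using side_run_skip[OF encode_expr_no_separator that, of True j \<sigma> code g "[]"]
    by (simp add: base_def) (simp add: side_run_def)
  then show ?thesis
    using True side_run_expr[OF assms(1,3,4), of "4 # encode_expr code g" True j] assms(5)
    by (simp add: encode_equation_eq base_def side_run_separator sum_times_of_bool)
next
  case False
  have "side_run False j \<sigma> (encode_expr code f @ 4 # encode_expr code g) i = side_run False j \<sigma> (encode_expr code g) (m + i)"
    using side_run_skip[OF encode_expr_no_separator assms(4), of False j \<sigma> code f] assms(4)
    by (simp add: base_def side_run_separator)
  moreover have "side_run False j \<sigma> [] (m + k) = of_bool (k = j)" for k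
    by (simp add: side_run_def)
  ultimately show ?thesis
    using False side_run_expr[OF assms(2,3,4), of "[]" False j] assms(5)
    by (simp add: encode_equation_eq base_def sum_times_of_bool)
qed

text \<open>A nonzero difference of entries is cancelled by some \<open>a\<close> and kills the
  product; equal sides leave only the nonzero factors \<open>a\<close>. Subtraction is written with
  \<open>- 1\<close> because recognizable functions are closed under sums and products.\<close>

definition indicator :: "(nat list \<Rightarrow> 'a mat) \<Rightarrow> nat list \<Rightarrow> 'a" where
  "indicator \<sigma> w = (\<Prod>(i, j, a)\<in>{..<m} \<times> {..<m} \<times> (UNIV - {0}).
     side_run True j \<sigma> w i + (- 1) * side_run False j \<sigma> w i + a)"

lemma recognizable_indicator: "recognizable characters indicator"
proof -
  have "recognizable characters (\<lambda>\<sigma> w. side_run True j \<sigma> w i + (- 1) * side_run False j \<sigma> w i + a)"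
    if "i < m" for i j and a :: 'a
    by (intro recognizable_add recognizable_mult recognizable_const recognizable_side that
        one_in_characters mult_in_characters)
  then have "recognizable characters (\<lambda>\<sigma> w. \<Prod>z\<in>{..<m} \<times> {..<m} \<times> (UNIV - {0}). case z of (i, j, a) \<Rightarrow>
     side_run True j \<sigma> w i + (- 1) * side_run False j \<sigma> w i + a)"
    by (intro recognizable_prod) (auto intro: one_in_characters mult_in_characters)
  then show ?thesis unfolding indicator_def[abs_def] .
qed

lemma indicator_nonzero_iff:
  assumes "f \<in> group_exprs G" and "g \<in> group_exprs G" and "\<sigma> \<in> assignments"
  shows "indicator \<sigma> (encode_equation code f g) \<noteq> 0 \<longleftrightarrow>
    expr_value G (\<lambda>v. \<sigma> (binary v)) f = expr_value G (\<lambda>v. \<sigma> (binary v)) g"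
proof -
  let ?F = "expr_value G (\<lambda>v. \<sigma> (binary v)) f" and ?G = "expr_value G (\<lambda>v. \<sigma> (binary v)) g"
  have mat: "?F \<in> carrier_mat m m" "?G \<in> carrier_mat m m"
    using assms by (auto intro!: expr_value_carrier_mat simp: assignments_def)
  have "indicator \<sigma> (encode_equation code f g) \<noteq> 0 \<longleftrightarrow>
      (\<forall>i<m. \<forall>j<m. \<forall>a. a \<noteq> 0 \<longrightarrow> ?F $$ (i, j) - ?G $$ (i, j) + a \<noteq> 0)"
    using side_run_equation[OF assms] by (auto simp: indicator_def prod_zero_iff)
  also have "\<dots> \<longleftrightarrow> (\<forall>i<m. \<forall>j<m. ?F $$ (i, j) = ?G $$ (i, j))"
    by (metis add.inverse_inverse add.right_inverse add_0 diff_add_cancel diff_self neg_equal_0_iff_equal)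
  also have "\<dots> \<longleftrightarrow> ?F = ?G" using mat by (auto intro!: eq_matI)
  finally show ?thesis .
qed

lemma eq_solvable_iff_indicator:
  assumes "f \<in> group_exprs G" and "g \<in> group_exprs G"
  shows "eq_solvable G f g \<longleftrightarrow> (\<exists>\<sigma>\<in>assignments. indicator \<sigma> (encode_equation code f g) \<noteq> 0)"
proof
  assume "eq_solvable G f g"
  then obtain \<rho> where \<rho>: "\<And>v. \<rho> v \<in> carrier G" "expr_value G \<rho> f = expr_value G \<rho> g"
    unfolding eq_solvable_def by blast
  \<comment> \<open>On words that name no variable the inverse is arbitrary, but the value lies in
    the carrier anyway.\<close>
  define \<sigma> where "\<sigma> u = \<rho> (inv_into UNIV binary u)" for u
  have "inj binary" by (rule injI) (rule binary_inject)
  then have "(\<lambda>v. \<sigma> (binary v)) = \<rho>" by (simp add: \<sigma>_def)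
  moreover have "\<sigma> \<in> assignments" using \<rho>(1) by (simp add: \<sigma>_def assignments_def)
  ultimately show "\<exists>\<sigma>\<in>assignments. indicator \<sigma> (encode_equation code f g) \<noteq> 0"
    using \<rho>(2) indicator_nonzero_iff[OF assms] by auto
next
  assume "\<exists>\<sigma>\<in>assignments. indicator \<sigma> (encode_equation code f g) \<noteq> 0"
  then show "eq_solvable G f g"
    unfolding eq_solvable_def using indicator_nonzero_iff[OF assms] by (auto simp: assignments_def)
qed

lemma encode_equation_symbols:
  assumes "f \<in> group_exprs G" and "g \<in> group_exprs G"
  shows "set (encode_equation code f g) \<subseteq> {1..<5 + card (carrier G)}"
proof -
  have factor: "set (encode_factor code t) \<subseteq> {1..<5 + card (carrier G)}" if "\<forall>c. t = Const c \<longrightarrow> c \<in> carrier G" for t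
    using that code digit_binary by (cases t) (fastforce simp: bij_betw_def)+
  have "set (encode_expr code f) \<subseteq> {1..<5 + card (carrier G)}" if f: "f \<in> group_exprs G" for f
  proof
    fix a assume "a \<in> set (encode_expr code f)"
    then obtain t where t: "t \<in> set f" "a \<in> set (encode_factor code t)" by (auto simp: encode_expr_def)
    moreover have "\<forall>c. t = Const c \<longrightarrow> c \<in> carrier G" using t(1) f by (auto simp: group_exprs_def)
    ultimately show "a \<in> {1..<5 + card (carrier G)}" using factor by blast
  qed
  then show ?thesis using assms by (simp add: encode_equation_eq)
qed

end

section \<open>Time bounds and conclusion\<close>

lemma poly_nat_mono: "a \<le> b \<Longrightarrow> poly p a \<le> poly p b" for p :: "nat poly"
  by (induction p) (auto intro: add_mono mult_mono)

lemma answers_within_mono: "answers_within M w b t \<Longrightarrow> t \<le> t' \<Longrightarrow> answers_within M w b t'"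
  unfolding answers_within_def using order_trans by blast

text \<open>Every factor takes at most \<open>length f + length g\<close> symbols: an index
  \<open>v\<close> has at most \<open>v\<close> digits, and the marker 3 is compensated by
  \<open>v\<close> being less than this total. The 1 is the separator.\<close>

lemma length_encode_equation_le:
  assumes "vars f \<union> vars g \<subseteq> {..<length f + length g}"
  shows "length (encode_equation code f g) \<le> (length f + length g) ^ 2 + 1"
proof -
  let ?L = "length f + length g"
  have factor: "length (encode_factor code t) \<le> ?L" if "t \<in> set f \<union> set g" for t
  proof (cases t)
    case (Var v)
    then have "v < ?L" using that assms by (auto simp: vars_def)
    then show ?thesis using Var length_binary_le[of v] by simp
  next
    case (Const c)
    have "0 < ?L" using that by auto
    then show ?thesis using Const by (simp only: encode_factor.simps list.size)
  qed
  have "length (encode_expr code h) \<le> length h * ?L" if "set h \<subseteq> set f \<union> set g" for h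
    using that
  proof (induction h)
    case (Cons t h)
    then show ?case using factor[of t] by (simp add: encode_expr_def)
  qed (simp add: encode_expr_def)
  from this[of f] this[of g] show ?thesis
    by (simp add: encode_equation_eq power2_eq_square algebra_simps)
qed

theorem theorem1p1:
  fixes G :: "'a::{field,finite} mat monoid"
  assumes "semipattern_group G"
  shows "eq_solvability_in_P G"
  unfolding eq_solvability_in_P_def
proof (intro allI impI)
  fix code :: "'a mat \<Rightarrow> nat" assume code: "bij_betw code (carrier G) {..<card (carrier G)}"
  obtain m P S where P: "P \<subseteq> {(i, j). i < j \<and> j < m}"
    and S: "\<forall>i<m. subgroup (S i :: 'a set) field_units"
    and G: "G = (triangular_group m)\<lparr>carrier := pattern_set m P <#>\<^bsub>triangular_group m\<^esub> diagonal_set m S\<rparr>"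
    using assms unfolding semipattern_group_def by blast
  interpret semipattern_coding m P S G code
    by (intro semipattern_coding.intro semipattern.intro semipattern_coding_axioms.intro P S[rule_format] G code)
  have "finite (carrier G)" using bij_betw_finite[OF code] by simp
  then obtain M p where M: "wf_tm M" and run: "\<And>w. set w \<subseteq> {1..<5 + card (carrier G)} \<Longrightarrow>
      answers_within M w (\<exists>\<sigma>\<in>assignments. indicator \<sigma> w \<noteq> 0) (poly p (length w))"
    by (rule recognizable_nonvanishing_in_P[OF recognizable_indicator _, of "5 + card (carrier G)"]) auto
  \<comment> \<open>\<open>[:1, 0, 1:]\<close> is the bound on the length of the encoding; the sum
    of both polynomials serves both time bounds.\<close>
  define r where "r = p + pcompose p [:1, 0, 1:]"
  show "\<exists>M (p :: nat poly). wf_tm M \<and>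
    (\<forall>f\<in>group_exprs G. \<forall>g\<in>group_exprs G.
      answers_within M (encode_equation code f g) (eq_solvable G f g) (poly p (length (encode_equation code f g))) \<and>
      (vars f \<union> vars g \<subseteq> {..<length f + length g} \<longrightarrow>
        answers_within M (encode_equation code f g) (eq_solvable G f g) (poly p (length f + length g))))"
  proof (intro exI[of _ M] exI[of _ r] conjI ballI impI M)
    fix f g assume fg: "f \<in> group_exprs G" "g \<in> group_exprs G"
    let ?w = "encode_equation code f g"
    have ans: "answers_within M ?w (eq_solvable G f g) (poly p (length ?w))"
      using run[OF encode_equation_symbols[OF fg]] eq_solvable_iff_indicator[OF fg] by simp
    then show "answers_within M ?w (eq_solvable G f g) (poly r (length ?w))"
      by (rule answers_within_mono) (simp add: r_def)
    assume "vars f \<union> vars g \<subseteq> {..<length f + length g}"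
    then have "poly p (length ?w) \<le> poly p ((length f + length g) ^ 2 + 1)"
      by (intro poly_nat_mono length_encode_equation_le)
    also have "\<dots> \<le> poly r (length f + length g)"
      by (simp add: r_def poly_pcompose power2_eq_square)
    finally show "answers_within M ?w (eq_solvable G f g) (poly r (length f + length g))"
      using answers_within_mono[OF ans] by blast
  qed
qed

end
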